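(* Let $H$ be a finite-dimensional complex Hilbert space and let $0<p<\infty$ with $p\neq 2$. If $x,y\in S(C_p(H))$ satisfy $$\|x-e\|_p^p=\|y-e\|_p^p\qquad\text{for all } e\in\mathcal U_{\min}(H),$$ then $x=y$.
   Context: For finite-dimensional $H$, $C_p(H)=\mathcal B(H)$ equipped with $\|x\|_p=(\mathrm{Tr}(|x|^p))^{1/p}$, the $\ell_p$-(quasi-)norm of the singular values of $x$; $S(C_p(H))=\{x\in C_p(H):\|x\|_p=1\}$. $\mathcal U_{\min}(H)$ is the set of minimal (i.e. rank-one) partial isometries on $H$, that is, the operators $\eta\otimes\xi: a\mapsto\langle a,\xi\rangle\eta$ with $\eta,\xi\in H$ unit vectors. *)

theory Defs
  imports Complex_Main
begin

text \<open>
  A finite-dimensional complex Hilbert space: a complex vector space (on a whole type) with an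
  inner product that is linear in the first argument. Completeness is not listed because it
  follows from finite dimension; for the same reason \<open>B(H)\<close> is the set of all linear maps.
\<close>

locale fin_dim_complex_hilbert = vector_space scaleC
  for scaleC :: "complex \<Rightarrow> 'a::ab_group_add \<Rightarrow> 'a" (infixr "*\<^sub>C" 75) +
  fixes cinner :: "'a \<Rightarrow> 'a \<Rightarrow> complex"
  assumes cinner_add_left: "cinner (u + v) w = cinner u w + cinner v w"
    and cinner_scale_left: "cinner (c *\<^sub>C u) v = c * cinner u v"
    and cinner_commute: "cinner u v = cnj (cinner v u)"
    and cinner_pos: "u \<noteq> 0 \<Longrightarrow> Re (cinner u u) > 0"
    and fin_dim: "\<exists>B. finite B \<and> span B = UNIV"
begin

definition hnorm :: "'a \<Rightarrow> real" where
  "hnorm v = sqrt (Re (cinner v v))"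

definition operators :: "('a \<Rightarrow> 'a) set" where
  "operators = {t. Vector_Spaces.linear scaleC scaleC t}"

definition op_adjoint :: "('a \<Rightarrow> 'a) \<Rightarrow> 'a \<Rightarrow> 'a" where
  "op_adjoint t = (THE s. \<forall>u v. cinner (t u) v = cinner u (s v))"

definition positive_op :: "('a \<Rightarrow> 'a) \<Rightarrow> bool" where
  "positive_op t \<longleftrightarrow> t \<in> operators \<and> (\<forall>v. cinner (t v) v \<in> \<real> \<and> Re (cinner (t v) v) \<ge> 0)"

text \<open>The absolute value \<open>|t|\<close> is the positive square root of \<open>t\<^sup>* t\<close>.\<close>

definition op_abs :: "('a \<Rightarrow> 'a) \<Rightarrow> 'a \<Rightarrow> 'a" where
  "op_abs t = (THE a. positive_op a \<and> a \<circ> a = op_adjoint t \<circ> t)"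

text \<open>
  The power \<open>a\<^sup>p\<close> of a positive operator \<open>a\<close> for real \<open>p > 0\<close>, given by the functional calculus:
  it multiplies each eigenvector of \<open>a\<close> for the eigenvalue \<open>l\<close> by \<open>l\<^sup>p\<close>. The eigenvectors of
  \<open>a\<close> span the space, so this determines the operator. On the kernel of \<open>a\<close> it is \<open>0\<close>, as
  \<open>0 powr p = 0\<close>.
\<close>

definition op_powr :: "('a \<Rightarrow> 'a) \<Rightarrow> real \<Rightarrow> 'a \<Rightarrow> 'a" where
  "op_powr a p = (THE b. b \<in> operators \<and>
     (\<forall>(l::real) v. a v = of_real l *\<^sub>C v \<longrightarrow> b v = of_real (l powr p) *\<^sub>C v))"

definition orthonormal_basis :: "'a set \<Rightarrow> bool" where
  "orthonormal_basis B \<longleftrightarrow> finite B \<and> span B = UNIV \<and>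
     (\<forall>u\<in>B. \<forall>v\<in>B. cinner u v = (if u = v then 1 else 0))"

text \<open>The value of the trace does not depend on the orthonormal basis that is chosen.\<close>

definition op_trace :: "('a \<Rightarrow> 'a) \<Rightarrow> complex" where
  "op_trace t = (\<Sum>b\<in>(SOME B. orthonormal_basis B). cinner (t b) b)"

text \<open>\<open>\<parallel>t\<parallel>\<^sub>p = (Tr |t|\<^sup>p)\<close> to the power \<open>1/p\<close>; the trace of a positive operator is real.\<close>

definition schatten_norm :: "real \<Rightarrow> ('a \<Rightarrow> 'a) \<Rightarrow> real" where
  "schatten_norm p t = Re (op_trace (op_powr (op_abs t) p)) powr (1 / p)"

definition schatten_sphere :: "real \<Rightarrow> ('a \<Rightarrow> 'a) set" where
  "schatten_sphere p = {t \<in> operators. schatten_norm p t = 1}"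

definition rank_one :: "'a \<Rightarrow> 'a \<Rightarrow> 'a \<Rightarrow> 'a" where
  "rank_one \<eta> \<xi> = (\<lambda>a. cinner a \<xi> *\<^sub>C \<eta>)"

definition minimal_partial_isometries :: "('a \<Rightarrow> 'a) set" where
  "minimal_partial_isometries = {rank_one \<eta> \<xi> | \<eta> \<xi>. hnorm \<eta> = 1 \<and> hnorm \<xi> = 1}"

end

end

theory Submission
  imports Defs "HOL-Analysis.Convex" "HOL-Computational_Algebra.Fundamental_Theorem_Algebra"
begin

text \<open>
  Let \<open>x v\<^sub>i = s\<^sub>i u\<^sub>i\<close> be a singular value decomposition of \<open>x\<close>; it suffices that
  \<open>y v\<^sub>i = s\<^sub>i u\<^sub>i\<close> for all \<open>i\<close>. Let \<open>F(\<eta>, \<xi>)\<close> be the common value of \<open>Tr |x + \<eta> \<otimes> \<xi>|\<^sup>p\<close> and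
  \<open>Tr |y + \<eta> \<otimes> \<xi>|\<^sup>p\<close> on unit vectors. Along a curve of unit vectors \<open>\<eta>(t)\<close> through \<open>u\<^sub>i\<close>, an upper
  bound in terms of \<open>x\<close> shows that \<open>F(\<eta>(t), v\<^sub>i)\<close> does not increase to first order, while a lower
  bound in terms of \<open>y\<close> touches \<open>F\<close> at \<open>t = 0\<close> and is differentiable there, even when
  \<open>y + u\<^sub>i \<otimes> v\<^sub>i\<close> is singular and \<open>p < 1\<close>. So the derivative of the lower bound vanishes; the same
  holds for the adjoints. For \<open>p \<noteq> 1\<close> this makes \<open>(v\<^sub>i, u\<^sub>i)\<close> a singular pair of
  \<open>y + u\<^sub>i \<otimes> v\<^sub>i\<close>, hence \<open>y v\<^sub>i = \<tau> u\<^sub>i\<close> with \<open>\<tau>\<close> real, and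
  \<open>F(u\<^sub>i, v\<^sub>i) - F(- u\<^sub>i, v\<^sub>i) = |\<tau> + 1|\<^sup>p - |\<tau> - 1|\<^sup>p\<close> determines \<open>\<tau> \<in> [-1, 1]\<close>. The case
  \<open>p = 1\<close> uses the duality of the trace norm with the unitary operators.
\<close>

section \<open>Scalar inequalities and derivatives\<close>

text \<open>The convex function \<open>x powr (- q)\<close> lies above its tangent at the mean
  \<open>M\<close>; after scaling \<open>M\<close> to 1 this follows from
  \<open>ln x \<le> x - 1\<close> and \<open>1 + x \<le> exp x\<close>. As the power is decreasing,
  an upper bound \<open>S\<close> of the mean suffices, and later only such a bound is
  available.\<close>

lemma jensen_powr_neg:
  fixes a t :: "'i \<Rightarrow> real"
  assumes "finite A" "\<And>k. k \<in> A \<Longrightarrow> 0 \<le> a k" "(\<Sum>k\<in>A. a k) = 1" "\<And>k. k \<in> A \<Longrightarrow> 0 < t k"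
    and S: "(\<Sum>k\<in>A. a k * t k) \<le> S" and "0 \<le> q"
  shows "S powr (- q) \<le> (\<Sum>k\<in>A. a k * t k powr (- q))"
proof -
  define M where "M = (\<Sum>k\<in>A. a k * t k)"
  obtain k where "k \<in> A" "0 < a k"
    using assms(2,3) by (metis less_eq_real_def sum.neutral zero_neq_one)
  then have M: "0 < M"
    unfolding M_def using assms(1,2,4) by (intro sum_pos2[of A k]) (auto simp: less_imp_le)
  have tangent: "1 - q * (x - 1) \<le> x powr (- q)" if "0 < x" for x :: real
  proof -
    have "1 - q * (x - 1) \<le> 1 + (- q * ln x)"
      using ln_le_minus_one[OF that] \<open>0 \<le> q\<close> mult_left_mono[of "ln x" "x - 1" q] by simp
    also have "\<dots> \<le> exp (- q * ln x)" by (rule exp_ge_add_one_self)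
    finally show ?thesis using that by (simp add: powr_def)
  qed
  have "S powr (- q) \<le> M powr (- q)"
    using S M \<open>0 \<le> q\<close> by (intro powr_mono2') (auto simp: M_def)
  also have "\<dots> = M powr (- q) * (\<Sum>k\<in>A. a k * (1 - q * (t k / M - 1)))"
  proof -
    have "(\<Sum>k\<in>A. a k * (1 - q * (t k / M - 1))) = (\<Sum>k\<in>A. (1 + q) * a k - q / M * (a k * t k))"
      by (intro sum.cong refl) (simp add: field_simps)
    also have "\<dots> = (1 + q) - q / M * M"
      unfolding sum_subtractf sum_distrib_left[symmetric] M_def[symmetric] assms(3) by simp
    finally show ?thesis using M by simp
  qed
  also have "\<dots> \<le> M powr (- q) * (\<Sum>k\<in>A. a k * (t k / M) powr (- q))"
    using assms(2,4) M by (intro mult_left_mono sum_mono tangent) auto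
  also have "\<dots> = (\<Sum>k\<in>A. a k * t k powr (- q))"
    unfolding sum_distrib_left
  proof (intro sum.cong refl)
    fix k assume "k \<in> A"
    then have "t k powr (- q) = (M * (t k / M)) powr (- q)" using M by simp
    also have "\<dots> = M powr (- q) * (t k / M) powr (- q)"
      by (rule powr_mult)
    finally show "M powr (- q) * (a k * (t k / M) powr (- q)) = a k * t k powr (- q)" by simp
  qed
  finally show ?thesis .
qed

text \<open>Concave counterpart: the tangent inequality at the mean, scaled to 1, is Young's
  inequality with weights \<open>q\<close> and \<open>1 - q\<close>. A zero mean makes every term
  zero because \<open>0 powr q = 0\<close>.\<close>

lemma jensen_powr:
  fixes a t :: "'i \<Rightarrow> real"
  assumes "finite A" "\<And>k. k \<in> A \<Longrightarrow> 0 \<le> a k" "(\<Sum>k\<in>A. a k) = 1" "\<And>k. k \<in> A \<Longrightarrow> 0 \<le> t k"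
    and "0 < q" "q \<le> 1"
  shows "(\<Sum>k\<in>A. a k * t k powr q) \<le> (\<Sum>k\<in>A. a k * t k) powr q"
proof -
  define M where "M = (\<Sum>k\<in>A. a k * t k)"
  have "0 \<le> M" unfolding M_def using assms by (intro sum_nonneg) auto
  show ?thesis
  proof (cases "M = 0")
    case True
    then have "a k * t k = 0" if "k \<in> A" for k
      using that assms sum_nonneg_eq_0_iff[of A "\<lambda>k. a k * t k"] by (auto simp: M_def)
    then have "(\<Sum>k\<in>A. a k * t k powr q) = 0"
      by (intro sum.neutral) auto
    then show ?thesis by simp
  next
    case False
    then have M: "0 < M" using \<open>0 \<le> M\<close> by simp
    have tangent: "x powr q \<le> 1 + q * (x - 1)" if "0 \<le> x" for x :: real
    proof (cases "x = 0")
      case False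
      then show ?thesis
        using Youngs_inequality_0[of q "1 - q" x 1] assms(5,6) that by (simp add: algebra_simps)
    qed (use assms in simp)
    have "(\<Sum>k\<in>A. a k * t k powr q) = M powr q * (\<Sum>k\<in>A. a k * (t k / M) powr q)"
      unfolding sum_distrib_left
    proof (intro sum.cong refl)
      fix k assume "k \<in> A"
      then have "t k powr q = (M * (t k / M)) powr q" using M by simp
      also have "\<dots> = M powr q * (t k / M) powr q"
        by (rule powr_mult)
      finally show "a k * t k powr q = M powr q * (a k * (t k / M) powr q)" by simp
    qed
    also have "\<dots> \<le> M powr q * (\<Sum>k\<in>A. a k * (1 + q * (t k / M - 1)))"
      using assms(2,4) M by (intro mult_left_mono sum_mono tangent) auto
    also have "(\<Sum>k\<in>A. a k * (1 + q * (t k / M - 1))) = (\<Sum>k\<in>A. (1 - q) * a k + q / M * (a k * t k))"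
      by (intro sum.cong refl) (simp add: field_simps)
    also have "\<dots> = (1 - q) + q / M * M"
      unfolding sum.distrib sum_distrib_left[symmetric] M_def[symmetric] assms(3) by simp
    finally show ?thesis using M by (simp add: M_def)
  qed
qed

text \<open>By the product rule, the derivative of a matrix power at 0 is a sum of products of a
  diagonal matrix, \<open>D\<close> and a diagonal matrix, so each diagonal entry is a multiple of
  \<open>D j j = 0\<close>. \<open>P N\<close> stands for the \<open>N\<close>-th power of
  \<open>M\<close>.\<close>

lemma power_of_diagonal_derivative:
  fixes M :: "real \<Rightarrow> nat \<Rightarrow> nat \<Rightarrow> complex" and P :: "nat \<Rightarrow> real \<Rightarrow> nat \<Rightarrow> nat \<Rightarrow> complex"
  assumes M0: "\<And>j k. j < n \<Longrightarrow> k < n \<Longrightarrow> M 0 j k = (if j = k then d j else 0)"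
    and MD: "\<And>j k. j < n \<Longrightarrow> k < n \<Longrightarrow> ((\<lambda>t. M t j k) has_vector_derivative D j k) (at 0)"
    and D0: "\<And>j. j < n \<Longrightarrow> D j j = 0"
    and P0: "\<And>t j k. j < n \<Longrightarrow> k < n \<Longrightarrow> P 0 t j k = (if j = k then 1 else 0)"
    and PS: "\<And>N t j k. j < n \<Longrightarrow> k < n \<Longrightarrow> P (Suc N) t j k = (\<Sum>l<n. P N t j l * M t l k)"
  shows "(\<forall>j<n. \<forall>k<n. P N 0 j k = (if j = k then d j ^ N else 0)) \<and>
    (\<exists>E. \<forall>j<n. E j j = 0 \<and> (\<forall>k<n. ((\<lambda>t. P N t j k) has_vector_derivative E j k) (at 0)))"
proof (induction N)
  case 0
  show ?case by (auto simp: P0 intro!: exI[of _ "\<lambda>_ _. 0"])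
next
  case (Suc N)
  then obtain E where E: "\<And>j. j < n \<Longrightarrow> E j j = 0"
      "\<And>j k. j < n \<Longrightarrow> k < n \<Longrightarrow> ((\<lambda>t. P N t j k) has_vector_derivative E j k) (at 0)"
    and PN: "\<And>j k. j < n \<Longrightarrow> k < n \<Longrightarrow> P N 0 j k = (if j = k then d j ^ N else 0)"
    by blast
  define E' where "E' j k = (\<Sum>l<n. P N 0 j l * D l k + E j l * M 0 l k)" for j k
  have "P (Suc N) 0 j k = (if j = k then d j ^ Suc N else 0)" if "j < n" "k < n" for j k
  proof -
    have "P (Suc N) 0 j k = (\<Sum>l<n. if l = j then (if j = k then d j ^ Suc N else 0) else 0)"
      unfolding PS[OF that] using that by (intro sum.cong refl) (auto simp: PN M0)
    then show ?thesis using that by simp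
  qed
  moreover have "E' j j = 0" if "j < n" for j
    unfolding E'_def using that by (intro sum.neutral) (auto simp: PN M0 D0 E)
  moreover have "((\<lambda>t. P (Suc N) t j k) has_vector_derivative E' j k) (at 0)" if "j < n" "k < n" for j k
    unfolding PS[OF that] E'_def
    by (intro has_vector_derivative_sum has_vector_derivative_mult MD E(2)) (use that in auto)
  ultimately show ?case by blast
qed

lemma has_vector_derivative_rotation:
  "((\<lambda>t. of_real (cos t) * a + of_real (sin t) * b) has_vector_derivative b) (at 0)"
  for a b :: complex
proof -
  have "((\<lambda>t::real. of_real (cos t) :: complex) has_vector_derivative of_real 0) (at 0)"
    by (rule has_vector_derivative_of_real) (auto intro!: derivative_eq_intros)
  moreover have "((\<lambda>t::real. of_real (sin t) :: complex) has_vector_derivative of_real 1) (at 0)"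
    by (rule has_vector_derivative_of_real) (auto intro!: derivative_eq_intros)
  ultimately have "((\<lambda>t. of_real (cos t) * a + of_real (sin t) * b) has_vector_derivative of_real 0 * a + of_real 1 * b) (at 0)"
    by (intro has_vector_derivative_add has_vector_derivative_mult_left)
  then show ?thesis by simp
qed

lemma DERIV_cmod_rotation:
  "((\<lambda>t. (cmod (1 + of_real (cos t - 1) * a + of_real (sin t) * b))\<^sup>2) has_real_derivative 2 * Re b) (at 0)"
  by (auto simp: cmod_power2 intro!: derivative_eq_intros)

text \<open>Here \<alpha> and \<beta> are to be the coordinates of \<open>v i\<close> and
  \<open>u i\<close> in the singular bases of \<open>z\<close>. If \<open>l\<close> and
  \<open>l'\<close> are nonzero, composing the two relations gives
  \<open>(\<sigma> k powr (p - 1))\<^sup>2 = l * l'\<close> wherever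
  \<open>\<alpha> k \<noteq> 0\<close>. So for \<open>p \<noteq> 1\<close> the singular value is
  constant on the common support, and the power \<open>p - 1\<close> can be replaced by the power
  1.\<close>

lemma proportional_coordinates:
  fixes \<alpha> \<beta> :: "nat \<Rightarrow> complex" and \<sigma> :: "nat \<Rightarrow> real" and l l' p :: real
  assumes \<sigma>: "\<And>k. 0 \<le> \<sigma> k" and p: "p \<noteq> 1"
    and norm: "(\<Sum>k<n. (cmod (\<alpha> k))\<^sup>2) = 1" "(\<Sum>k<n. (cmod (\<beta> k))\<^sup>2) = 1"
    and l: "\<And>k. k < n \<Longrightarrow> of_real (\<sigma> k powr (p - 1)) * \<alpha> k = of_real l * \<beta> k"
    and l': "\<And>k. k < n \<Longrightarrow> of_real (\<sigma> k powr (p - 1)) * \<beta> k = of_real l' * \<alpha> k"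
  obtains \<mu> :: real where "\<And>k. k < n \<Longrightarrow> of_real (\<sigma> k) * \<alpha> k = of_real \<mu> * \<beta> k"
    "\<And>k. k < n \<Longrightarrow> of_real (\<sigma> k) * \<beta> k = of_real \<mu> * \<alpha> k"
proof (cases "l = 0 \<or> l' = 0")
  case True
  \<comment> \<open>\<open>\<sigma> k powr (p - 1)\<close> vanishes exactly when
    \<open>\<sigma> k\<close> does, also for \<open>p < 1\<close>, since
    \<open>0 powr q = 0\<close>. Hence one zero multiplier makes all the products vanish, and \<mu>
    is 0.\<close>
  have "of_real (\<sigma> k) * \<alpha> k = 0 \<and> of_real (\<sigma> k) * \<beta> k = 0" if "k < n" for k
    using True l[OF that] l'[OF that] by auto
  then show ?thesis using that[of 0] by simp
next
  case False
  then have nz: "l \<noteq> 0" "l' \<noteq> 0" by auto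
  have z: "\<alpha> k = 0 \<longleftrightarrow> \<beta> k = 0" if "k < n" for k
    using l[OF that] l'[OF that] nz by auto
  have pos: "0 < \<sigma> k" if "k < n" "\<alpha> k \<noteq> 0" for k
    using l'[OF that(1)] nz that \<sigma>[of k] by (cases "\<sigma> k = 0") auto
  have sq: "(\<sigma> k powr (p - 1))\<^sup>2 = l * l'" if "k < n" "\<alpha> k \<noteq> 0" for k
  proof -
    have "of_real ((\<sigma> k powr (p - 1))\<^sup>2) * \<alpha> k = of_real (\<sigma> k powr (p - 1)) * (of_real l * \<beta> k)"
      by (simp add: power2_eq_square l[OF that(1), symmetric])
    also have "\<dots> = of_real l * (of_real (\<sigma> k powr (p - 1)) * \<beta> k)"
      by simp
    also have "\<dots> = of_real (l * l') * \<alpha> k"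
      by (simp add: l'[OF that(1)])
    finally show ?thesis using that(2) by (metis mult_cancel_right of_real_eq_iff)
  qed
  obtain m where m: "m < n" "\<alpha> m \<noteq> 0"
  proof (cases "\<exists>m<n. \<alpha> m \<noteq> 0")
    case False
    then show ?thesis using norm(1) by simp
  qed (use that in blast)
  define c where "c = \<sigma> m powr (p - 1)"
  have same: "\<sigma> k = \<sigma> m" if "k < n" "\<alpha> k \<noteq> 0" for k
  proof -
    have "\<sigma> k powr (p - 1) = \<sigma> m powr (p - 1)"
      using sq[OF that] sq[OF m] by (metis power2_eq_iff_nonneg powr_ge_zero)
    then have "(\<sigma> k powr (p - 1)) powr (1 / (p - 1)) = (\<sigma> m powr (p - 1)) powr (1 / (p - 1))"
      by simp
    then show ?thesis using p pos[OF that] pos[OF m] by (simp add: powr_powr)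
  qed
  have \<beta>: "\<beta> k = of_real (c / l) * \<alpha> k" if "k < n" for k
    using l[OF that] z[OF that] same[OF that] nz by (cases "\<alpha> k = 0") (auto simp: c_def field_simps)
  have "(\<Sum>k<n. (cmod (\<beta> k))\<^sup>2) = (c / l)\<^sup>2 * (\<Sum>k<n. (cmod (\<alpha> k))\<^sup>2)"
    unfolding sum_distrib_left
    by (intro sum.cong refl) (simp add: \<beta> norm_mult norm_divide power_mult_distrib power_divide)
  \<comment> \<open>A real ratio between unit vectors is 1 or -1, hence its own inverse; so the
    single value \<open>c / l * \<sigma> m\<close> serves in both relations.\<close>
  then have cl: "(c / l)\<^sup>2 = 1" using norm by simp
  have cl': "of_real (c / l) * (of_real (c / l) * x) = x" for x :: complex
  proof -
    have "of_real (c / l) * (of_real (c / l) * x) = of_real ((c / l)\<^sup>2) * x"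
      by (simp only: power2_eq_square of_real_mult mult.assoc)
    then show ?thesis using cl by simp
  qed
  have \<sigma>\<alpha>: "of_real (\<sigma> k) * \<alpha> k = of_real (\<sigma> m) * \<alpha> k" if "k < n" for k
    using same[OF that] by (cases "\<alpha> k = 0") auto
  show ?thesis
  proof (rule that[of "c / l * \<sigma> m"])
    fix k assume k: "k < n"
    have "of_real (c / l * \<sigma> m) * \<beta> k = of_real (\<sigma> m) * (of_real (c / l) * (of_real (c / l) * \<alpha> k))"
      by (simp only: \<beta>[OF k] of_real_mult mult.assoc mult.left_commute)
    then show "of_real (\<sigma> k) * \<alpha> k = of_real (c / l * \<sigma> m) * \<beta> k"
      by (simp only: cl' \<sigma>\<alpha>[OF k])
    have "of_real (\<sigma> k) * \<beta> k = of_real (c / l) * (of_real (\<sigma> k) * \<alpha> k)"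
      by (simp only: \<beta>[OF k] mult.left_commute)
    then show "of_real (\<sigma> k) * \<beta> k = of_real (c / l * \<sigma> m) * \<alpha> k"
      by (simp only: \<sigma>\<alpha>[OF k] of_real_mult mult.assoc)
  qed
qed

text \<open>On \<open>[-1, 1]\<close>, \<open>\<bar>a + 1\<bar>\<close> increases and
  \<open>\<bar>a - 1\<bar>\<close> decreases with \<open>a\<close>, so the difference of the powers
  is strictly increasing.\<close>

lemma powr_difference_inj:
  fixes a b p :: real
  assumes "0 < p" "\<bar>a\<bar> \<le> 1" "\<bar>b\<bar> \<le> 1"
    and "\<bar>a + 1\<bar> powr p - \<bar>a - 1\<bar> powr p = \<bar>b + 1\<bar> powr p - \<bar>b - 1\<bar> powr p"
  shows "a = b"
proof -
  have "\<bar>a + 1\<bar> powr p - \<bar>a - 1\<bar> powr p < \<bar>b + 1\<bar> powr p - \<bar>b - 1\<bar> powr p"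
    if "a < b" "\<bar>a\<bar> \<le> 1" "\<bar>b\<bar> \<le> 1" for a b
    using powr_less_mono2[of p "\<bar>a + 1\<bar>" "\<bar>b + 1\<bar>"] powr_less_mono2[of p "\<bar>b - 1\<bar>" "\<bar>a - 1\<bar>"] that assms(1)
    by linarith
  then show ?thesis using assms by (metis less_irrefl linorder_less_linear)
qed

context fin_dim_complex_hilbert
begin

subsection \<open>Orthonormal families and adjoints\<close>

lemma cinner_add_right: "cinner w (u + v) = cinner w u + cinner w v"
  by (metis cinner_add_left cinner_commute complex_cnj_add)

lemma cinner_scale_right: "cinner u (c *\<^sub>C v) = cnj c * cinner u v"
  by (metis cinner_commute cinner_scale_left complex_cnj_mult)

lemma cinner_zero_left [simp]: "cinner 0 v = 0"
  using cinner_scale_left[of 0 0 v] by simp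

lemma cinner_zero_right [simp]: "cinner v 0 = 0"
  using cinner_scale_right[of v 0 0] by simp

lemma cinner_diff_left: "cinner (u - v) w = cinner u w - cinner v w"
  using cinner_add_left[of "u - v" v w] by simp

lemma cinner_diff_right: "cinner w (u - v) = cinner w u - cinner w v"
  using cinner_add_right[of w "u - v" v] by simp

lemma cinner_sum_left: "cinner (\<Sum>i\<in>A. f i) w = (\<Sum>i\<in>A. cinner (f i) w)"
  by (induction A rule: infinite_finite_induct) (auto simp: cinner_add_left)

lemma cinner_sum_right: "cinner w (\<Sum>i\<in>A. f i) = (\<Sum>i\<in>A. cinner w (f i))"
  by (induction A rule: infinite_finite_induct) (auto simp: cinner_add_right)

lemmas cinner_linear = cinner_add_left cinner_add_right cinner_diff_left cinner_diff_right
  cinner_scale_left cinner_scale_right cinner_sum_left cinner_sum_right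

lemma cinner_self_nonneg: "0 \<le> Re (cinner v v)"
  by (cases "v = 0") (use cinner_pos[of v] in auto)

lemma cinner_self: "cinner v v = of_real ((hnorm v)\<^sup>2)"
proof -
  have "Im (cinner v v) = 0"
    by (metis Reals_cnj_iff cinner_commute complex_is_Real_iff)
  then show ?thesis
    by (simp add: complex_eq_iff hnorm_def cinner_self_nonneg)
qed

lemma hnorm_nonneg [simp]: "0 \<le> hnorm v"
  by (simp add: hnorm_def cinner_self_nonneg)

lemma hnorm_eq_0_iff [simp]: "hnorm v = 0 \<longleftrightarrow> v = 0"
  by (cases "v = 0") (use cinner_pos[of v] in \<open>auto simp: hnorm_def\<close>)

lemma cinner_self_eq_0_iff [simp]: "cinner v v = 0 \<longleftrightarrow> v = 0"
  by (simp add: cinner_self)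

lemma hnorm_scale: "hnorm (c *\<^sub>C v) = cmod c * hnorm v"
proof -
  have "cinner (c *\<^sub>C v) (c *\<^sub>C v) = of_real ((cmod c * hnorm v)\<^sup>2)"
    unfolding cinner_scale_left cinner_scale_right cinner_self[of v]
    by (simp add: power_mult_distrib complex_norm_square del: of_real_power flip: of_real_power)
  then have "(hnorm (c *\<^sub>C v))\<^sup>2 = (cmod c * hnorm v)\<^sup>2"
    by (metis cinner_self of_real_eq_iff)
  then show ?thesis
    by (simp add: power2_eq_iff_nonneg)
qed

lemma hnorm_normalize: "v \<noteq> 0 \<Longrightarrow> hnorm (of_real (1 / hnorm v) *\<^sub>C v) = 1"
  by (simp add: hnorm_scale del: of_real_divide)

lemma cinner_eq_0_commute: "cinner u v = 0 \<longleftrightarrow> cinner v u = 0"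
  by (metis cinner_commute complex_cnj_zero_iff)

lemma cinner_ext:
  assumes "\<And>w. cinner u w = cinner v w"
  shows "u = v"
  using assms[of "u - v"] cinner_self_eq_0_iff[of "u - v"] by (simp add: cinner_diff_left)

lemma cinner_ext_right:
  assumes "\<And>w. cinner w u = cinner w v"
  shows "u = v"
  by (rule cinner_ext) (metis assms cinner_commute)

definition onfam :: "'i set \<Rightarrow> ('i \<Rightarrow> 'a) \<Rightarrow> bool" where
  "onfam J v \<longleftrightarrow> (\<forall>i\<in>J. \<forall>j\<in>J. cinner (v i) (v j) = (if i = j then 1 else 0))"

abbreviation hdim :: nat where "hdim \<equiv> dim UNIV"

text \<open>Only orthonormality is asked for: \<open>hdim\<close> orthonormal vectors span by
  \<open>onb_expand\<close>. Numbering the vectors lets two bases be paired index by index in a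
  singular value decomposition.\<close>

abbreviation onb :: "(nat \<Rightarrow> 'a) \<Rightarrow> bool" where
  "onb v \<equiv> onfam {..<hdim} v"

lemma onfamD: "onfam J v \<Longrightarrow> i \<in> J \<Longrightarrow> j \<in> J \<Longrightarrow> cinner (v i) (v j) = (if i = j then 1 else 0)"
  by (simp add: onfam_def)

lemma onfam_subset: "onfam J v \<Longrightarrow> I \<subseteq> J \<Longrightarrow> onfam I v"
  unfolding onfam_def by blast

lemma onfam_hnorm: "onfam J v \<Longrightarrow> i \<in> J \<Longrightarrow> hnorm (v i) = 1"
  by (simp add: onfam_def hnorm_def)

lemma onfam_inj: "onfam J v \<Longrightarrow> inj_on v J"
  unfolding onfam_def by (metis inj_onI zero_neq_one)

lemma onfam_independent:
  assumes "onfam J v"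
  shows "independent (v ` J)"
  unfolding dependent_explicit
proof clarify
  fix t c w
  assume t: "finite t" "t \<subseteq> v ` J" "(\<Sum>v\<in>t. c v *\<^sub>C v) = 0" "w \<in> t" "c w \<noteq> 0"
  have "cinner a w = (if a = w then 1 else 0)" if a: "a \<in> t" for a
  proof -
    obtain i j where "i \<in> J" "j \<in> J" "a = v i" "w = v j"
      using a t(2) \<open>w \<in> t\<close> by blast
    then show ?thesis
      using onfamD[OF assms, of i j] inj_onD[OF onfam_inj[OF assms], of i j] by auto
  qed
  then have "cinner (\<Sum>v\<in>t. c v *\<^sub>C v) w = (\<Sum>v\<in>t. if v = w then c v else 0)"
    by (auto simp: cinner_linear intro!: sum.cong)
  with t show False by simp
qed

lemma finite_span_UNIV: obtains B where "finite B" "span B = UNIV" "independent B" "card B = hdim"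
proof -
  obtain B where B: "B \<subseteq> UNIV" "independent B" "UNIV \<subseteq> span B" "card B = hdim"
    using basis_exists by blast
  obtain C where "finite C" "span C = UNIV"
    using fin_dim by blast
  then have "finite B"
    using independent_span_bound[of C B] B by auto
  then show ?thesis
    using that B by blast
qed

lemma independent_card_le: "independent S \<Longrightarrow> finite S \<and> card S \<le> hdim"
  by (metis finite_span_UNIV independent_span_bound top_greatest)

lemma onfam_sum_cinner:
  assumes "onfam J v" "finite J" "j \<in> J"
  shows "cinner (\<Sum>i\<in>J. c i *\<^sub>C v i) (v j) = c j"
proof -
  have "cinner (\<Sum>i\<in>J. c i *\<^sub>C v i) (v j) = (\<Sum>i\<in>J. if i = j then c i else 0)"
    unfolding cinner_sum_left cinner_scale_left
    using assms by (intro sum.cong refl) (simp add: onfamD)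
  then show ?thesis using assms by simp
qed

text \<open>A nonzero remainder \<open>r\<close>, normalized, would be orthonormal vector number
  \<open>hdim + 1\<close>, more than an independent family can have.\<close>

lemma onb_expand:
  assumes "onb v"
  shows "(\<Sum>i<hdim. cinner w (v i) *\<^sub>C v i) = w"
proof (rule ccontr)
  let ?P = "\<Sum>i<hdim. cinner w (v i) *\<^sub>C v i"
  assume ne: "?P \<noteq> w"
  define r where "r = w - ?P"
  have "r \<noteq> 0" using ne by (simp add: r_def)
  define v' where "v' i = (if i < hdim then v i else of_real (1 / hnorm r) *\<^sub>C r)" for i
  have r0: "cinner r (v i) = 0" if "i < hdim" for i
    using onfam_sum_cinner[OF assms] that by (simp add: r_def cinner_diff_left)
  then have "cinner (v i) r = 0" if "i < hdim" for i
    using that cinner_eq_0_commute by blast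
  moreover have "cinner (of_real (1 / hnorm r) *\<^sub>C r) (of_real (1 / hnorm r) *\<^sub>C r) = 1"
    by (subst cinner_self) (simp add: hnorm_normalize[OF \<open>r \<noteq> 0\<close>] del: of_real_divide)
  ultimately have on: "onfam {..<Suc hdim} v'"
    using assms r0 by (auto simp: onfam_def v'_def less_Suc_eq cinner_scale_left cinner_scale_right)
  then have "card (v' ` {..<Suc hdim}) = Suc hdim"
    by (simp add: card_image onfam_inj)
  then show False
    using independent_card_le[OF onfam_independent[OF on]] by simp
qed

lemma onb_parseval:
  assumes "onb v"
  shows "cinner a b = (\<Sum>i<hdim. cinner a (v i) * cinner (v i) b)"
  by (subst onb_expand[OF assms, of a, symmetric]) (simp add: cinner_linear)

lemma onb_hnorm:
  assumes "onb v"
  shows "(hnorm a)\<^sup>2 = (\<Sum>i<hdim. (cmod (cinner a (v i)))\<^sup>2)"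
proof -
  have "cinner a a = of_real (\<Sum>i<hdim. (cmod (cinner a (v i)))\<^sup>2)"
    unfolding of_real_sum complex_norm_square
    by (subst onb_parseval[OF assms]) (metis cinner_commute)
  then show ?thesis
    by (metis cinner_self of_real_eq_iff)
qed

lemma onb_ext:
  assumes "onb v" "\<And>i. i < hdim \<Longrightarrow> cinner a (v i) = cinner b (v i)"
  shows "a = b"
  using assms(2) by (subst (1 2) onb_expand[OF assms(1), symmetric]) (auto intro!: sum.cong)

lemma bessel:
  assumes "onfam J v" "finite J"
  shows "(\<Sum>j\<in>J. (cmod (cinner a (v j)))\<^sup>2) \<le> (hnorm a)\<^sup>2"
proof -
  let ?P = "\<Sum>i\<in>J. cinner a (v i) *\<^sub>C v i" and ?s = "\<Sum>j\<in>J. (cmod (cinner a (v j)))\<^sup>2"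
  have c: "cinner ?P (v j) = cinner a (v j)" if "j \<in> J" for j
    using onfam_sum_cinner[OF assms that] .
  have pp: "cinner ?P ?P = of_real ?s"
    unfolding of_real_sum complex_norm_square cinner_sum_right[of ?P]
    by (intro sum.cong refl) (simp only: c cinner_scale_right mult.commute)
  have ap: "cinner a ?P = of_real ?s"
    unfolding of_real_sum complex_norm_square
    by (auto simp: cinner_linear mult.commute intro!: sum.cong)
  have pa: "cinner ?P a = of_real ?s"
    by (metis ap cinner_commute complex_cnj_complex_of_real)
  have "cinner (a - ?P) (a - ?P) = cinner a a - of_real ?s"
    by (simp add: cinner_diff_left cinner_diff_right pp ap pa)
  then have "Re (cinner a a) - ?s \<ge> 0"
    using cinner_self_nonneg[of "a - ?P"] by simp
  then show ?thesis by (simp add: cinner_self)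
qed

lemma onfam_missing_vector:
  assumes "onfam J v" "J \<subset> {..<hdim}"
  obtains w where "w \<noteq> 0" "\<And>j. j \<in> J \<Longrightarrow> cinner w (v j) = 0"
proof -
  have fin: "finite J" and card: "card J < hdim"
    using assms(2) finite_subset psubset_card_mono[of "{..<hdim}" J] by auto
  have "span (v ` J) \<noteq> UNIV"
    using dim_le_card[of UNIV "v ` J"] fin card card_image_le[OF fin, of v] by auto
  then obtain a where a: "a \<notin> span (v ` J)" by blast
  let ?w = "a - (\<Sum>i\<in>J. cinner a (v i) *\<^sub>C v i)"
  have "(\<Sum>i\<in>J. cinner a (v i) *\<^sub>C v i) \<in> span (v ` J)"
    by (intro span_sum span_scale span_base) auto
  then have "?w \<noteq> 0" using a by auto
  moreover have "cinner ?w (v j) = 0" if "j \<in> J" for j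
    using onfam_sum_cinner[OF assms(1) fin that] by (simp add: cinner_diff_left)
  ultimately show ?thesis using that by blast
qed

lemma onfam_insert:
  assumes "onfam J v" "hnorm w = 1" "\<And>j. j \<in> J \<Longrightarrow> cinner w (v j) = 0" "k \<notin> J"
  shows "onfam (insert k J) (v(k := w))"
proof -
  have "cinner (v j) w = 0" if "j \<in> J" for j
    using assms(3)[OF that] cinner_eq_0_commute by blast
  then show ?thesis
    using assms by (auto simp: onfam_def cinner_self[of w])
qed

text \<open>The predicate \<open>Q\<close> allows the same induction to produce eigenvectors.\<close>

lemma onb_extend_with:
  assumes "onfam J v" "J \<subseteq> {..<hdim}"
    and "\<And>j. j \<in> J \<Longrightarrow> Q (v j)"
    and step: "\<And>J v. onfam J v \<Longrightarrow> J \<subset> {..<hdim} \<Longrightarrow> (\<And>j. j \<in> J \<Longrightarrow> Q (v j)) \<Longrightarrow>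
      \<exists>w. hnorm w = 1 \<and> (\<forall>j\<in>J. cinner w (v j) = 0) \<and> Q w"
  shows "\<exists>w. onb w \<and> (\<forall>j\<in>J. w j = v j) \<and> (\<forall>j<hdim. Q (w j))"
  using assms(1-3)
proof (induction "card ({..<hdim} - J)" arbitrary: J v)
  case 0
  then have "J = {..<hdim}" by auto
  with 0 show ?case by auto
next
  case (Suc m)
  then have sub: "J \<subset> {..<hdim}" by auto
  then obtain k where k: "k < hdim" "k \<notin> J" by auto
  obtain w where w: "hnorm w = 1" "\<forall>j\<in>J. cinner w (v j) = 0" "Q w"
    using step[OF Suc.prems(1) sub Suc.prems(3)] by blast
  have "{..<hdim} - insert k J = ({..<hdim} - J) - {k}" by blast
  then have m: "m = card ({..<hdim} - insert k J)"
    using Suc.hyps(2) k by (simp add: card_Diff_singleton)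
  have on: "onfam (insert k J) (v(k := w))"
    using onfam_insert[OF Suc.prems(1) w(1) _ k(2)] w(2) by blast
  have Qk: "Q ((v(k := w)) j)" if "j \<in> insert k J" for j
    using that Suc.prems(3) w(3) by auto
  obtain u where "onb u" "\<forall>j\<in>insert k J. u j = (v(k := w)) j" "\<forall>j<hdim. Q (u j)"
    using Suc.hyps(1)[OF m on _ Qk] k Suc.prems(2) by auto
  then show ?case using k by (intro exI[of _ u]) auto
qed

lemma onb_extend:
  assumes "onfam J v" "J \<subseteq> {..<hdim}"
  obtains w where "onb w" "\<And>j. j \<in> J \<Longrightarrow> w j = v j"
proof -
  have "\<exists>w. onb w \<and> (\<forall>j\<in>J. w j = v j) \<and> (\<forall>j<hdim. True)"
  proof (rule onb_extend_with[OF assms])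
    fix J and v :: "nat \<Rightarrow> 'a"
    assume "onfam J v" "J \<subset> {..<hdim}"
    then obtain w where w: "w \<noteq> 0" "\<And>j. j \<in> J \<Longrightarrow> cinner w (v j) = 0"
      using onfam_missing_vector by blast
    then show "\<exists>w. hnorm w = 1 \<and> (\<forall>j\<in>J. cinner w (v j) = 0) \<and> True"
      using hnorm_normalize[OF w(1)]
      by (intro exI[of _ "of_real (1 / hnorm w) *\<^sub>C w"]) (auto simp: cinner_scale_left)
  qed simp
  then show ?thesis using that by blast
qed

lemma onb_exists: obtains v where "onb v"
  using onb_extend[of "{}" "\<lambda>_. 0"] by (auto simp: onfam_def)

section \<open>Linear operators and their adjoints\<close>

lemma operators_add: "t \<in> operators \<Longrightarrow> t (u + v) = t u + t v"
  by (simp add: operators_def Vector_Spaces.linear.axioms module_hom.add linear_iff_module_hom)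

lemma operators_scale: "t \<in> operators \<Longrightarrow> t (c *\<^sub>C v) = c *\<^sub>C t v"
  by (simp add: operators_def module_hom.scale linear_iff_module_hom)

lemma operatorsI:
  assumes "\<And>u v. t (u + v) = t u + t v" "\<And>c v. t (c *\<^sub>C v) = c *\<^sub>C t v"
  shows "t \<in> operators"
  using assms unfolding operators_def
  by (simp add: Vector_Spaces.linear_iff vector_space_axioms)

lemma operators_0: "t \<in> operators \<Longrightarrow> t 0 = 0"
  using operators_scale[of t 0 0] by simp

lemma operators_diff: "t \<in> operators \<Longrightarrow> t (u - v) = t u - t v"
  using operators_add[of t "u - v" v] by simp

lemma operators_sum: "t \<in> operators \<Longrightarrow> t (\<Sum>i\<in>A. f i) = (\<Sum>i\<in>A. t (f i))"
  by (induction A rule: infinite_finite_induct) (auto simp: operators_add operators_0)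

lemma operators_comp: "s \<in> operators \<Longrightarrow> t \<in> operators \<Longrightarrow> s \<circ> t \<in> operators"
  by (rule operatorsI) (auto simp: operators_add operators_scale)

lemma operators_plus: "s \<in> operators \<Longrightarrow> t \<in> operators \<Longrightarrow> (\<lambda>v. s v + t v) \<in> operators"
  by (rule operatorsI) (auto simp: operators_add operators_scale scale_right_distrib)

lemma operators_minus: "s \<in> operators \<Longrightarrow> t \<in> operators \<Longrightarrow> (\<lambda>v. s v - t v) \<in> operators"
  by (rule operatorsI) (auto simp: operators_add operators_scale scale_right_diff_distrib)

lemma rank_one_operators: "rank_one \<eta> \<xi> \<in> operators"
  by (rule operatorsI) (simp_all add: rank_one_def cinner_linear scale_left_distrib)

lemma diagonal_operators: "(\<lambda>a. \<Sum>i<hdim. (c i * cinner a (v i)) *\<^sub>C u i) \<in> operators"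
  by (rule operatorsI)
    (simp_all add: cinner_linear scale_left_distrib sum.distrib scale_sum_right algebra_simps)

lemma operators_ext_onb:
  assumes "onb v" "s \<in> operators" "t \<in> operators" "\<And>i. i < hdim \<Longrightarrow> s (v i) = t (v i)"
  shows "s = t"
proof
  fix a
  have "s a = s (\<Sum>i<hdim. cinner a (v i) *\<^sub>C v i)"
    by (simp add: onb_expand[OF assms(1)])
  also have "\<dots> = t (\<Sum>i<hdim. cinner a (v i) *\<^sub>C v i)"
    using assms by (simp add: operators_sum operators_scale)
  also have "\<dots> = t a"
    by (simp add: onb_expand[OF assms(1)])
  finally show "s a = t a" .
qed

lemma diagonal_apply:
  assumes "onb v" "i < hdim"
  shows "(\<Sum>j<hdim. (c j * cinner (v i) (v j)) *\<^sub>C u j) = c i *\<^sub>C u i"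
proof -
  have "(\<Sum>j<hdim. (c j * cinner (v i) (v j)) *\<^sub>C u j) = (\<Sum>j<hdim. if j = i then c j *\<^sub>C u j else 0)"
    using assms by (intro sum.cong refl) (simp add: onfamD[OF assms(1)])
  then show ?thesis using assms(2) by simp
qed

lemma op_adjoint_unique:
  assumes "\<And>u v. cinner (t u) v = cinner u (s v)"
  shows "op_adjoint t = s"
  unfolding op_adjoint_def
proof (rule the_equality)
  fix s' assume "\<forall>u v. cinner (t u) v = cinner u (s' v)"
  then have "\<And>v. s' v = s v" by (metis assms cinner_ext_right)
  then show "s' = s" by blast
qed (use assms in blast)

text \<open>The definite description in \<open>op_adjoint\<close> needs a witness; the coordinates
  \<open>cinner v (t (b i))\<close> in an orthonormal basis give one.\<close>

lemma op_adjoint_cinner: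
  assumes t: "t \<in> operators"
  shows "cinner (t u) v = cinner u (op_adjoint t v)"
proof -
  obtain b where b: "onb b" using onb_exists .
  define s where "s v = (\<Sum>i<hdim. cinner v (t (b i)) *\<^sub>C b i)" for v
  have *: "cinner (t u) v = cinner u (s v)" for u v
  proof -
    have "cinner (t u) v = cinner (t (\<Sum>i<hdim. cinner u (b i) *\<^sub>C b i)) v"
      by (simp add: onb_expand[OF b])
    also have "\<dots> = (\<Sum>i<hdim. cinner u (b i) * cinner (t (b i)) v)"
      using t by (simp add: operators_sum operators_scale cinner_linear)
    also have "\<dots> = cinner u (s v)"
      unfolding s_def cinner_sum_right cinner_scale_right
      by (intro sum.cong refl) (metis cinner_commute mult.commute)
    finally show ?thesis .
  qed
  then show ?thesis using op_adjoint_unique[of t s] by metis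
qed

lemma op_adjoint_cinner':
  assumes t: "t \<in> operators"
  shows "cinner (op_adjoint t u) v = cinner u (t v)"
  by (metis assms cinner_commute op_adjoint_cinner)

lemma op_adjoint_operators:
  assumes t: "t \<in> operators"
  shows "op_adjoint t \<in> operators"
  by (rule operatorsI; rule cinner_ext)
    (simp_all add: op_adjoint_cinner'[OF t] cinner_linear)

lemma op_adjoint_plus:
  assumes "s \<in> operators" "t \<in> operators"
  shows "op_adjoint (\<lambda>v. s v + t v) = (\<lambda>v. op_adjoint s v + op_adjoint t v)"
  by (rule op_adjoint_unique) (simp add: cinner_linear assms op_adjoint_cinner)

lemma op_adjoint_rank_one: "op_adjoint (rank_one \<eta> \<xi>) = rank_one \<xi> \<eta>"
  by (rule op_adjoint_unique)
    (simp add: rank_one_def cinner_linear cinner_commute[of v \<eta> for v] mult.commute)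

subsection \<open>Singular value decompositions\<close>

definition poly_apply :: "complex poly \<Rightarrow> ('a \<Rightarrow> 'a) \<Rightarrow> 'a \<Rightarrow> 'a" where
  "poly_apply P t w = (\<Sum>k\<le>degree P. coeff P k *\<^sub>C (t ^^ k) w)"

lemma poly_apply_bound:
  assumes "degree P \<le> n"
  shows "poly_apply P t w = (\<Sum>k\<le>n. coeff P k *\<^sub>C (t ^^ k) w)"
  unfolding poly_apply_def
  by (rule sum.mono_neutral_left) (use assms in \<open>auto simp: coeff_eq_0\<close>)

lemma poly_apply_0 [simp]: "poly_apply 0 t w = 0"
  by (simp add: poly_apply_def)

lemma poly_apply_pCons:
  assumes "t \<in> operators"
  shows "poly_apply (pCons a P) t w = a *\<^sub>C w + t (poly_apply P t w)"
proof -
  have "poly_apply (pCons a P) t w = (\<Sum>k\<le>Suc (degree P). coeff (pCons a P) k *\<^sub>C (t ^^ k) w)"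
    by (rule poly_apply_bound) (simp add: degree_pCons_le)
  also have "\<dots> = a *\<^sub>C w + t (poly_apply P t w)"
    by (subst sum.atMost_Suc_shift)
      (simp add: poly_apply_def operators_sum[OF assms] operators_scale[OF assms])
  finally show ?thesis .
qed

lemma poly_apply_linear_mult:
  assumes "t \<in> operators"
  shows "poly_apply ([:- a, 1:] * P) t w = t (poly_apply P t w) - a *\<^sub>C poly_apply P t w"
proof -
  have "degree ([:- a, 1:] * P) \<le> Suc (degree P)"
    using degree_mult_le[of "[:- a, 1:]" P] by (simp del: mult_pCons_left)
  then have "poly_apply ([:- a, 1:] * P) t w =
      (\<Sum>k\<le>Suc (degree P). (coeff (pCons 0 P) k - a * coeff P k) *\<^sub>C (t ^^ k) w)"
    by (subst poly_apply_bound[of _ "Suc (degree P)"]) (auto simp: algebra_simps)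
  also have "\<dots> = (\<Sum>k\<le>Suc (degree P). coeff (pCons 0 P) k *\<^sub>C (t ^^ k) w) -
      a *\<^sub>C (\<Sum>k\<le>Suc (degree P). coeff P k *\<^sub>C (t ^^ k) w)"
    by (simp add: scale_left_diff_distrib sum_subtractf scale_sum_right del: sum.atMost_Suc)
  also have "\<dots> = poly_apply (pCons 0 P) t w - a *\<^sub>C poly_apply P t w"
    by (simp add: poly_apply_bound[of "pCons 0 P" "Suc (degree P)"]
        poly_apply_bound[of P "Suc (degree P)"] degree_pCons_le del: sum.atMost_Suc)
  finally show ?thesis
    by (simp add: poly_apply_pCons[OF assms])
qed

lemma poly_apply_mem:
  assumes "subspace W" "\<And>a. a \<in> W \<Longrightarrow> t a \<in> W" "w \<in> W"
  shows "poly_apply P t w \<in> W"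
proof -
  have "(t ^^ k) w \<in> W" for k
    by (induction k) (use assms in auto)
  then show ?thesis
    unfolding poly_apply_def using assms(1) by (intro subspace_sum subspace_scale)
qed

text \<open>The \<open>hdim + 1\<close> vectors \<open>(t ^^ k) w\<close> either repeat, which
  yields a difference of two monomials, or form a set too large to be independent, whose dependence
  relation supplies the coefficients. Dependence is a property of the set and does not see
  repetitions, hence the two cases.\<close>

lemma annihilating_poly:
  obtains P where "P \<noteq> 0" "poly_apply P t w = 0"
proof (cases "inj_on (\<lambda>k. (t ^^ k) w) {..hdim}")
  case False
  then obtain i j where ij: "i \<noteq> j" "(t ^^ i) w = (t ^^ j) w"
    by (auto simp: inj_on_def)
  let ?P = "monom 1 i - monom (1::complex) j"
  have "poly_apply ?P t w = (\<Sum>k\<le>max i j. coeff ?P k *\<^sub>C (t ^^ k) w)"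
    by (intro poly_apply_bound degree_diff_le order.trans[OF degree_monom_le]) auto
  also have "\<dots> = (\<Sum>k\<le>max i j. if k = i then (t ^^ k) w else 0) - (\<Sum>k\<le>max i j. if k = j then (t ^^ k) w else 0)"
    unfolding sum_subtractf[symmetric]
    by (intro sum.cong refl) (auto simp: scale_left_diff_distrib)
  also have "\<dots> = 0" using ij by simp
  finally have "poly_apply ?P t w = 0" .
  moreover have "?P \<noteq> 0"
    using ij(1) by (metis coeff_monom eq_iff_diff_eq_0 zero_neq_one)
  ultimately show ?thesis using that by blast
next
  case True
  let ?S = "(\<lambda>k. (t ^^ k) w) ` {..hdim}"
  have "card ?S = Suc hdim"
    using True by (simp add: card_image)
  then have "dependent ?S"
    using independent_card_le[of ?S] by auto
  then obtain u a where u: "(\<Sum>v\<in>?S. u v *\<^sub>C v) = 0" "a \<in> ?S" "u a \<noteq> 0"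
    by (subst (asm) dependent_finite) auto
  then obtain k where k: "k \<le> hdim" "u ((t ^^ k) w) \<noteq> 0" by auto
  define P where "P = (\<Sum>k\<le>hdim. monom (u ((t ^^ k) w)) k)"
  have c: "coeff P j = (if j \<le> hdim then u ((t ^^ j) w) else 0)" for j
  proof -
    have "coeff P j = (\<Sum>k\<le>hdim. if k = j then u ((t ^^ k) w) else 0)"
      by (simp add: P_def coeff_sum)
    then show ?thesis by simp
  qed
  have "degree P \<le> hdim"
    using c by (intro degree_le) auto
  then have "poly_apply P t w = (\<Sum>k\<le>hdim. u ((t ^^ k) w) *\<^sub>C (t ^^ k) w)"
    by (simp add: poly_apply_bound c)
  also have "\<dots> = 0"
    using u(1) True by (simp add: sum.reindex)
  finally have "poly_apply P t w = 0" .
  moreover have "P \<noteq> 0"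
    using c[of k] k by auto
  ultimately show ?thesis using that by blast
qed

text \<open>Split a root \<open>a\<close> off a polynomial annihilating \<open>w\<close>, with
  cofactor \<open>Q\<close>: either \<open>Q\<close> annihilates \<open>w\<close> too and has
  smaller degree, or \<open>poly_apply Q t w\<close> is an eigenvector for \<open>a\<close>. It lies
  in \<open>W\<close> because \<open>W\<close> is invariant.\<close>

lemma eigenvector_in_subspace:
  assumes t: "t \<in> operators" and W: "subspace W" "\<And>a. a \<in> W \<Longrightarrow> t a \<in> W"
    and w: "w \<in> W" "w \<noteq> 0"
  obtains v a where "v \<in> W" "v \<noteq> 0" "t v = a *\<^sub>C v"
proof -
  have "\<exists>v\<in>W. v \<noteq> 0 \<and> (\<exists>a. t v = a *\<^sub>C v)" if "P \<noteq> 0" "poly_apply P t w = 0" for P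
    using that
  proof (induction "degree P" arbitrary: P)
    case 0
    then obtain c where "P = [:c:]" by (metis degree_eq_zeroE)
    with 0 w show ?case by (simp add: poly_apply_pCons[OF t] operators_0[OF t])
  next
    case (Suc d)
    then obtain a where "poly P a = 0"
      by (metis constant_degree fundamental_theorem_of_algebra nat.simps(3))
    then obtain Q where Q: "P = [:- a, 1:] * Q"
      by (metis dvdE poly_eq_0_iff_dvd)
    then have "Q \<noteq> 0" "degree Q = d"
      using Suc.hyps(2) Suc.prems(1) by (auto simp: degree_mult_eq simp del: mult_pCons_left)
    show ?case
    proof (cases "poly_apply Q t w = 0")
      case True
      with Suc.hyps(1) \<open>Q \<noteq> 0\<close> \<open>degree Q = d\<close> show ?thesis by blast
    next
      case False
      have "t (poly_apply Q t w) = a *\<^sub>C poly_apply Q t w"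
        using Suc.prems(2) unfolding Q poly_apply_linear_mult[OF t] by simp
      moreover have "poly_apply Q t w \<in> W"
        by (rule poly_apply_mem[OF W(1) _ w(1)]) (rule W(2))
      ultimately show ?thesis using False by (intro bexI[of _ "poly_apply Q t w"]) auto
    qed
  qed
  moreover obtain P where "P \<noteq> 0" "poly_apply P t w = 0"
    using annihilating_poly .
  ultimately have "\<exists>v\<in>W. v \<noteq> 0 \<and> (\<exists>a. t v = a *\<^sub>C v)"
    by blast
  then show ?thesis
    using that by blast
qed

section \<open>Spectral theorem and singular bases with prescribed vectors\<close>

text \<open>Self-adjointness makes the orthogonal complement of the eigenvectors found so far
  invariant, so it contains a further one. Prescribing the first eigenvectors later allows a given
  singular pair to be kept.\<close>

lemma spectral_extend:
  assumes t: "t \<in> operators" and sa: "\<And>a b. cinner (t a) b = cinner a (t b)"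
    and J: "onfam J v" "J \<subseteq> {..<hdim}" "\<And>j. j \<in> J \<Longrightarrow> \<exists>c. t (v j) = c *\<^sub>C v j"
  obtains w where "onb w" "\<And>j. j \<in> J \<Longrightarrow> w j = v j" "\<And>j. j < hdim \<Longrightarrow> \<exists>c. t (w j) = c *\<^sub>C w j"
proof -
  have "\<exists>w. onb w \<and> (\<forall>j\<in>J. w j = v j) \<and> (\<forall>j<hdim. \<exists>c. t (w j) = c *\<^sub>C w j)"
  proof (rule onb_extend_with[where Q = "\<lambda>w. \<exists>c. t w = c *\<^sub>C w", OF J])
    fix J and v :: "nat \<Rightarrow> 'a"
    assume "onfam J v" "J \<subset> {..<hdim}" and ev: "\<And>j. j \<in> J \<Longrightarrow> \<exists>c. t (v j) = c *\<^sub>C v j"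
    then obtain w where w: "w \<noteq> 0" "\<And>j. j \<in> J \<Longrightarrow> cinner w (v j) = 0"
      using onfam_missing_vector by blast
    define W where "W = {a. \<forall>j\<in>J. cinner a (v j) = 0}"
    have "subspace W"
      by (auto simp: subspace_def W_def cinner_linear)
    moreover have "t a \<in> W" if "a \<in> W" for a
      using that ev by (fastforce simp: W_def sa cinner_scale_right)
    moreover have "w \<in> W" using w by (simp add: W_def)
    ultimately obtain u c where u: "u \<in> W" "u \<noteq> 0" "t u = c *\<^sub>C u"
      using eigenvector_in_subspace[OF t] w(1) by metis
    let ?u = "of_real (1 / hnorm u) *\<^sub>C u"
    have "t ?u = c *\<^sub>C ?u"
      by (simp add: operators_scale[OF t] u(3) mult.commute)
    then show "\<exists>w. hnorm w = 1 \<and> (\<forall>j\<in>J. cinner w (v j) = 0) \<and> (\<exists>c. t w = c *\<^sub>C w)"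
      using hnorm_normalize[OF u(2)] u(1)
      by (intro exI[of _ ?u]) (auto simp: cinner_scale_left W_def)
  qed auto
  then show ?thesis using that by blast
qed

text \<open>The coefficients \<open>c\<close> may be negative, so that perturbing a single coefficient by a real
  number stays within the class.\<close>

definition svd :: "('a \<Rightarrow> 'a) \<Rightarrow> (nat \<Rightarrow> 'a) \<Rightarrow> (nat \<Rightarrow> 'a) \<Rightarrow> (nat \<Rightarrow> real) \<Rightarrow> bool" where
  "svd z v u c \<longleftrightarrow> z \<in> operators \<and> onb v \<and> onb u \<and> (\<forall>i<hdim. z (v i) = of_real (c i) *\<^sub>C u i)"

lemma svdD:
  assumes "svd z v u c"
  shows "z \<in> operators" "onb v" "onb u" "i < hdim \<Longrightarrow> z (v i) = of_real (c i) *\<^sub>C u i"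
  using assms by (auto simp: svd_def)

lemma svd_adjoint_apply:
  assumes "svd z v u c" "i < hdim"
  shows "op_adjoint z (u i) = of_real (c i) *\<^sub>C v i"
proof (rule onb_ext[OF svdD(2)[OF assms(1)]])
  fix j assume j: "j < hdim"
  have "cinner (op_adjoint z (u i)) (v j) = cinner (u i) (z (v j))"
    by (rule op_adjoint_cinner'[OF svdD(1)[OF assms(1)]])
  then show "cinner (op_adjoint z (u i)) (v j) = cinner (of_real (c i) *\<^sub>C v i) (v j)"
    using j assms svdD[OF assms(1)] by (simp add: cinner_linear onfamD)
qed

lemma svd_adjoint:
  assumes "svd z v u c"
  shows "svd (op_adjoint z) u v c"
  using assms svd_adjoint_apply[OF assms] op_adjoint_operators by (simp add: svd_def)

text \<open>Diagonalize \<open>m\<close>, of which each prescribed \<open>v j\<close> is an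
  eigenvector. The images under \<open>z\<close> of distinct vectors of the eigenbasis are
  orthogonal; outside \<open>J\<close> the nonzero ones are normalized. The condition on the adjoint
  makes them orthogonal to the prescribed \<open>u j\<close>.\<close>

lemma svd_extend:
  assumes z: "z \<in> operators" and J: "J \<subseteq> {..<hdim}" "onfam J v" "onfam J u"
    and zv: "\<And>j. j \<in> J \<Longrightarrow> z (v j) = of_real (c j) *\<^sub>C u j"
    and zu: "\<And>j. j \<in> J \<Longrightarrow> op_adjoint z (u j) = of_real (c j) *\<^sub>C v j"
  obtains v' u' c' where "svd z v' u' c'"
    "\<And>j. j \<in> J \<Longrightarrow> v' j = v j \<and> u' j = u j \<and> c' j = c j" "\<And>j. j \<notin> J \<Longrightarrow> 0 \<le> c' j"
proof -
  define m where "m = op_adjoint z \<circ> z"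
  have m: "m \<in> operators"
    unfolding m_def by (intro operators_comp op_adjoint_operators z)
  have mc: "cinner (m a) b = cinner (z a) (z b)" for a b
    by (simp add: m_def op_adjoint_cinner'[OF z])
  have sa: "cinner (m a) b = cinner a (m b)" for a b
    by (metis mc cinner_commute)
  have "\<exists>d. m (v j) = d *\<^sub>C v j" if "j \<in> J" for j
    using that by (auto simp: m_def zv zu operators_scale[OF op_adjoint_operators[OF z]])
  then obtain w where w: "onb w" "\<And>j. j \<in> J \<Longrightarrow> w j = v j"
    and ev: "\<And>j. j < hdim \<Longrightarrow> \<exists>d. m (w j) = d *\<^sub>C w j"
    using spectral_extend[OF m sa J(2,1)] by metis
  have orth: "cinner (z (w i)) (z (w j)) = 0" if ij: "i < hdim" "j < hdim" "i \<noteq> j" for i j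
  proof -
    obtain d where "m (w i) = d *\<^sub>C w i" using ev ij by blast
    then show ?thesis
      using ij onfamD[OF w(1), of i j] by (simp add: cinner_scale_left flip: mc)
  qed
  \<comment> \<open>Indices outside \<open>J\<close> with image 0 have nothing to normalize; they
    stay out of \<open>K\<close> and receive arbitrary vectors when \<open>u0\<close> is completed
    to a basis.\<close>
  define K where "K = {k\<in>{..<hdim} - J. z (w k) \<noteq> 0}"
  define c' where "c' j = (if j \<in> J then c j else hnorm (z (w j)))" for j
  define u0 where "u0 j = (if j \<in> J then u j else of_real (1 / hnorm (z (w j))) *\<^sub>C z (w j))" for j
  have uJ: "cinner (z (w k)) (u j) = 0" if "j \<in> J" "k \<in> K" for j k
  proof -
    have "j < hdim" "k < hdim" "k \<noteq> j"
      using that J(1) by (auto simp: K_def)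
    then show ?thesis
      using that onfamD[OF w(1), of k j] by (simp add: w(2) zu op_adjoint_cinner[OF z] cinner_scale_right)
  qed
  then have uJ': "cinner (u j) (z (w k)) = 0" if "j \<in> J" "k \<in> K" for j k
    using that cinner_eq_0_commute by blast
  have on: "onfam (J \<union> K) u0"
    unfolding onfam_def
  proof (intro ballI)
    fix i j assume ij: "i \<in> J \<union> K" "j \<in> J \<union> K"
    consider "i \<in> J" "j \<in> J" | "i \<in> J" "j \<in> K" "j \<notin> J" | "i \<in> K" "j \<in> J" "i \<notin> J"
      | "i \<in> K" "j \<in> K" "i \<notin> J" "j \<notin> J" "i = j" | "i \<in> K" "j \<in> K" "i \<notin> J" "j \<notin> J" "i \<noteq> j"
      using ij by blast
    then show "cinner (u0 i) (u0 j) = (if i = j then 1 else 0)"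
    proof cases
      case 1 then show ?thesis using onfamD[OF J(3)] by (simp add: u0_def)
    next
      case 2 then show ?thesis using uJ' by (auto simp: u0_def cinner_linear)
    next
      case 3 then show ?thesis using uJ by (auto simp: u0_def cinner_linear)
    next
      case 4 then show ?thesis
        unfolding u0_def using hnorm_normalize[of "z (w i)"] cinner_self[of "of_real (1 / hnorm (z (w j))) *\<^sub>C z (w j)"]
        by (auto simp: K_def simp del: of_real_divide)
    next
      case 5 then show ?thesis using orth[of i j] by (auto simp: u0_def cinner_linear K_def)
    qed
  qed
  have sub: "J \<union> K \<subseteq> {..<hdim}"
    using J(1) by (auto simp: K_def)
  obtain u' where u': "onb u'" "\<And>j. j \<in> J \<union> K \<Longrightarrow> u' j = u0 j"
    using onb_extend[OF on sub] by blast
  have "z (w i) = of_real (c' i) *\<^sub>C u' i" if "i < hdim" for i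
  proof (cases "i \<in> J")
    case True
    then show ?thesis by (simp add: c'_def u' u0_def zv w)
  next
    case False
    show ?thesis
    proof (cases "z (w i) = 0")
      case True
      then show ?thesis using False by (simp add: c'_def)
    next
      case nz: False
      then have "i \<in> K" using False that by (simp add: K_def)
      then show ?thesis using False nz by (simp add: c'_def u' u0_def)
    qed
  qed
  then have "svd z w u' c'"
    using z w u' by (simp add: svd_def)
  then show ?thesis
    using that[of w u' c'] w(2) u'(2) by (auto simp: c'_def u0_def)
qed

lemma svd_exists:
  assumes "z \<in> operators"
  obtains v u c where "svd z v u c" "\<And>i. 0 \<le> c i"
  using svd_extend[OF assms, of "{}" "\<lambda>_. 0" "\<lambda>_. 0" "\<lambda>_. 0"] that by (auto simp: onfam_def)

lemma svd_pair:
  assumes z: "z \<in> operators" and "hnorm \<xi> = 1" "hnorm \<eta> = 1"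
    and "z \<xi> = of_real \<tau> *\<^sub>C \<eta>" "op_adjoint z \<eta> = of_real \<tau> *\<^sub>C \<xi>"
  obtains v u c where "svd z v u c" "v 0 = \<xi>" "u 0 = \<eta>" "c 0 = \<tau>" "0 < hdim"
proof -
  have 1: "onfam {0} (\<lambda>_. \<xi>)" "onfam {0} (\<lambda>_. \<eta>)"
    using assms by (auto simp: onfam_def cinner_self)
  have 0: "0 < hdim"
    using independent_card_le[OF onfam_independent[OF 1(1)]] by simp
  show ?thesis
    by (rule svd_extend[OF z, of "{0}" "\<lambda>_. \<xi>" "\<lambda>_. \<eta>" "\<lambda>_. \<tau>"]) (use 0 1 assms that in auto)
qed

section \<open>Trace, absolute value and Schatten norm through singular bases\<close>

text \<open>Frees \<open>op_trace\<close> from the basis chosen by \<open>SOME\<close>: number that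
  basis by \<open>f\<close>, expand each diagonal entry in \<open>v\<close> by Parseval's identity,
  swap the sums, and use Parseval's identity for \<open>f\<close>.\<close>

lemma onb_trace:
  assumes v: "onb v" and t: "t \<in> operators"
  shows "op_trace t = (\<Sum>i<hdim. cinner (t (v i)) (v i))"
proof -
  define B where "B = (SOME B. orthonormal_basis B)"
  have "orthonormal_basis (v ` {..<hdim})"
    unfolding orthonormal_basis_def
  proof (intro conjI ballI)
    show "span (v ` {..<hdim}) = UNIV"
    proof -
      have "w \<in> span (v ` {..<hdim})" for w
        by (subst onb_expand[OF v, symmetric]) (intro span_sum span_scale span_base, auto)
      then show ?thesis by blast
    qed
    fix a b assume "a \<in> v ` {..<hdim}" "b \<in> v ` {..<hdim}"
    then obtain i j where ij: "i < hdim" "a = v i" "j < hdim" "b = v j" by blast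
    then show "cinner a b = (if a = b then 1 else 0)"
      using onfamD[OF v, of i j] inj_onD[OF onfam_inj[OF v], of i j] by auto
  qed simp
  then have B: "orthonormal_basis B"
    unfolding B_def by (rule someI)
  then have onB: "onfam B id" and finB: "finite B" and indB: "independent B"
    using onfam_independent[of B id] by (auto simp: orthonormal_basis_def onfam_def)
  have cardB: "card B = hdim"
    using B basis_card_eq_dim[of B UNIV] indB by (simp add: orthonormal_basis_def)
  obtain f where f: "bij_betw f {..<hdim} B"
    using ex_bij_betw_nat_finite[OF finB] cardB by (auto simp: lessThan_atLeast0)
  then have onf: "onb f"
    using onB by (auto simp: onfam_def bij_betw_def inj_on_def)
  have "op_trace t = (\<Sum>i<hdim. cinner (t (f i)) (f i))"
    unfolding op_trace_def B_def[symmetric] by (rule sum.reindex_bij_betw[OF f, symmetric])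
  also have "\<dots> = (\<Sum>i<hdim. \<Sum>j<hdim. cinner (t (f i)) (v j) * cinner (v j) (f i))"
    by (intro sum.cong refl onb_parseval[OF v])
  also have "\<dots> = (\<Sum>j<hdim. \<Sum>i<hdim. cinner (v j) (f i) * cinner (f i) (op_adjoint t (v j)))"
    by (subst sum.swap) (simp add: op_adjoint_cinner[OF t] mult.commute)
  also have "\<dots> = (\<Sum>j<hdim. cinner (t (v j)) (v j))"
    by (simp add: onb_parseval[OF onf, symmetric] op_adjoint_cinner[OF t])
  finally show ?thesis .
qed

text \<open>Polarization: the form \<open>D\<close> vanishes on the diagonal, and testing it at
  \<open>v + w\<close> and \<open>v + \<i> *\<^sub>C w\<close> makes \<open>D w v\<close> equal to
  both \<open>- D v w\<close> and \<open>D v w\<close>.\<close>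

lemma positive_op_self_adjoint:
  assumes "positive_op a"
  shows "cinner (a v) w = cinner v (a w)"
proof -
  have a: "a \<in> operators" and re: "cnj (cinner (a v) v) = cinner (a v) v" for v
    using assms by (auto simp: positive_op_def Reals_cnj_iff)
  define D where "D v w = cinner (a v) w - cinner v (a w)" for v w
  have D0: "D v v = 0" for v
    using re[of v] cinner_commute[of v "a v"] by (simp add: D_def)
  have "D (v + w) (v + w) = D v v + D v w + D w v + D w w"
    by (simp add: D_def operators_add[OF a] cinner_linear)
  then have 1: "D v w + D w v = 0" by (simp add: D0)
  have "D (v + \<i> *\<^sub>C w) (v + \<i> *\<^sub>C w) = D v v - \<i> * D v w + \<i> * D w v + D w w"
    by (simp add: D_def operators_add[OF a] operators_scale[OF a] cinner_linear algebra_simps)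
  then have 2: "D w v = D v w" by (simp add: D0)
  have "D v w = 0" using 1 2 by simp
  then show ?thesis by (simp add: D_def)
qed

text \<open>The work is the uniqueness of the positive root. For another root \<open>b\<close>, the
  vector \<open>w\<close> by which \<open>b (v i)\<close> differs from \<open>c i\<close> times
  \<open>v i\<close> satisfies \<open>b w = - of_real (c i) *\<^sub>C w\<close>. If
  \<open>c i > 0\<close>, positivity of \<open>b\<close> gives \<open>w = 0\<close>; if
  \<open>c i = 0\<close>, self-adjointness gives \<open>b (v i) = 0\<close>.\<close>

lemma op_abs_svd:
  assumes z: "svd z v u c" and c: "\<And>i. i < hdim \<Longrightarrow> 0 \<le> c i"
  shows "op_abs z = (\<lambda>a. \<Sum>i<hdim. (of_real (c i) * cinner a (v i)) *\<^sub>C v i)" (is "_ = ?a")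
  unfolding op_abs_def
proof (rule the_equality)
  note v = svdD(2)[OF z]
  have av: "?a (v i) = of_real (c i) *\<^sub>C v i" if "i < hdim" for i
    using diagonal_apply[OF v that] .
  have zz: "(op_adjoint z \<circ> z) (v i) = of_real ((c i)\<^sup>2) *\<^sub>C v i" if "i < hdim" for i
    using that by (simp add: svdD(4)[OF z] svd_adjoint_apply[OF z]
        operators_scale[OF op_adjoint_operators[OF svdD(1)[OF z]]] power2_eq_square)
  have zzop: "op_adjoint z \<circ> z \<in> operators"
    by (intro operators_comp op_adjoint_operators svdD(1)[OF z])
  have "?a \<circ> ?a = op_adjoint z \<circ> z"
  proof (rule operators_ext_onb[OF v _ zzop])
    show "?a \<circ> ?a \<in> operators"
      by (intro operators_comp diagonal_operators)
    fix i assume i: "i < hdim"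
    show "(?a \<circ> ?a) (v i) = (op_adjoint z \<circ> z) (v i)"
      unfolding zz[OF i] using i
      by (simp only: o_apply av operators_scale[OF diagonal_operators]) (simp add: power2_eq_square)
  qed
  moreover have "positive_op ?a"
    unfolding positive_op_def
  proof (intro conjI allI diagonal_operators)
    fix w
    have "cinner (?a w) w = of_real (\<Sum>i<hdim. c i * (cmod (cinner w (v i)))\<^sup>2)"
      unfolding cinner_sum_left cinner_scale_left of_real_sum of_real_mult complex_norm_square
      by (intro sum.cong refl) (metis cinner_commute mult.assoc)
    moreover have "0 \<le> (\<Sum>i<hdim. c i * (cmod (cinner w (v i)))\<^sup>2)"
      by (intro sum_nonneg mult_nonneg_nonneg) (auto simp: c)
    ultimately show "cinner (?a w) w \<in> \<real>" "0 \<le> Re (cinner (?a w) w)" by auto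
  qed
  ultimately show "positive_op ?a \<and> ?a \<circ> ?a = op_adjoint z \<circ> z" by blast
  fix b assume b: "positive_op b \<and> b \<circ> b = op_adjoint z \<circ> z"
  then have bop: "b \<in> operators" by (simp add: positive_op_def)
  have bb: "b (b w) = op_adjoint z (z w)" for w
    using b by (metis o_apply)
  show "b = ?a"
  proof (rule operators_ext_onb[OF v bop diagonal_operators])
    fix i assume i: "i < hdim"
    have bbv: "b (b (v i)) = of_real ((c i)\<^sup>2) *\<^sub>C v i"
      using zz[OF i] by (simp add: bb)
    define w where "w = b (v i) - of_real (c i) *\<^sub>C v i"
    have bw: "b w = - of_real (c i) *\<^sub>C w"
      by (simp add: w_def operators_diff[OF bop] operators_scale[OF bop] bbv
          scale_right_diff_distrib power2_eq_square)
    have "w = 0"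
    proof (cases "c i = 0")
      case True
      then have "cinner (b (v i)) (b (v i)) = 0"
        using bbv positive_op_self_adjoint[of b "b (v i)" "v i"] b by simp
      then show ?thesis using True by (simp add: w_def)
    next
      case False
      have "cinner (b w) w = of_real (- c i * (hnorm w)\<^sup>2)"
        by (simp only: bw cinner_scale_left cinner_self) simp
      moreover have "0 \<le> Re (cinner (b w) w)" using b by (simp add: positive_op_def)
      ultimately have "c i * (hnorm w)\<^sup>2 \<le> 0" by (simp del: of_real_mult of_real_power)
      moreover have "0 < c i" using False c[OF i] by simp
      ultimately have "(hnorm w)\<^sup>2 \<le> 0" by (simp add: mult_le_0_iff)
      then show ?thesis by simp
    qed
    then show "b (v i) = ?a (v i)"
      using av[OF i] by (simp add: w_def)
  qed
qed

text \<open>An eigenvector for \<open>l\<close> has zero coordinates wherever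
  \<open>c i \<noteq> l\<close>, so the diagonal candidate qualifies; the basis vectors are
  themselves eigenvectors, so it is the only one.\<close>

lemma op_powr_diagonal:
  fixes c :: "nat \<Rightarrow> real"
  assumes v: "onb v"
  shows "op_powr (\<lambda>a. \<Sum>i<hdim. (of_real (c i) * cinner a (v i)) *\<^sub>C v i) p =
    (\<lambda>a. \<Sum>i<hdim. (of_real (c i powr p) * cinner a (v i)) *\<^sub>C v i)" (is "op_powr ?a p = ?b")
  unfolding op_powr_def
proof (rule the_equality)
  show "?b \<in> operators \<and> (\<forall>(l::real) w. ?a w = of_real l *\<^sub>C w \<longrightarrow> ?b w = of_real (l powr p) *\<^sub>C w)"
  proof (intro conjI allI impI diagonal_operators)
    fix l :: real and w assume aw: "?a w = of_real l *\<^sub>C w"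
    show "?b w = of_real (l powr p) *\<^sub>C w"
    proof (rule onb_ext[OF v])
      fix i assume i: "i < hdim"
      have "of_real (c i) * cinner w (v i) = of_real l * cinner w (v i)"
        using arg_cong[OF aw, of "\<lambda>x. cinner x (v i)"] onfam_sum_cinner[OF v finite_lessThan, of i] i
        by (simp add: cinner_scale_left)
      then have "of_real (c i powr p) * cinner w (v i) = of_real (l powr p) * cinner w (v i)"
        by auto
      then show "cinner (?b w) (v i) = cinner (of_real (l powr p) *\<^sub>C w) (v i)"
        using onfam_sum_cinner[OF v finite_lessThan, of i] i by (simp add: cinner_scale_left)
    qed
  qed
  fix b assume b: "b \<in> operators \<and> (\<forall>(l::real) w. ?a w = of_real l *\<^sub>C w \<longrightarrow> b w = of_real (l powr p) *\<^sub>C w)"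
  show "b = ?b"
  proof (rule operators_ext_onb[OF v _ diagonal_operators])
    fix i assume i: "i < hdim"
    have "?a (v i) = of_real (c i) *\<^sub>C v i"
      by (rule diagonal_apply[OF v i])
    then have "b (v i) = of_real (c i powr p) *\<^sub>C v i"
      using b by blast
    then show "b (v i) = ?b (v i)"
      by (simp only: diagonal_apply[OF v i])
  qed (use b in blast)
qed

lemma svd_abs_coeffs:
  assumes "svd z v u c"
  shows "svd z v (\<lambda>i. of_real (if c i < 0 then -1 else 1) *\<^sub>C u i) (\<lambda>i. \<bar>c i\<bar>)"
  using assms unfolding svd_def onfam_def by (auto simp: cinner_linear)

text \<open>For \<open>p > 0\<close> the outer exponents cancel and this is the trace of the
  \<open>p\<close>-th power of the absolute value, a plain sum of powers by
  \<open>schatten_pow_svd\<close>.\<close>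

definition schatten_pow :: "real \<Rightarrow> ('a \<Rightarrow> 'a) \<Rightarrow> real" where
  "schatten_pow p z = schatten_norm p z powr p"

lemma schatten_norm_svd:
  assumes "svd z v u c"
  shows "schatten_norm p z = (\<Sum>i<hdim. \<bar>c i\<bar> powr p) powr (1 / p)"
proof -
  let ?b = "\<lambda>a. \<Sum>i<hdim. (of_real (\<bar>c i\<bar> powr p) * cinner a (v i)) *\<^sub>C v i"
  note v = svdD(2)[OF assms]
  have "op_powr (op_abs z) p = ?b"
    by (simp only: op_abs_svd[OF svd_abs_coeffs[OF assms] abs_ge_zero] op_powr_diagonal[OF v])
  moreover have "op_trace ?b = (\<Sum>i<hdim. cinner (?b (v i)) (v i))"
    by (rule onb_trace[OF v diagonal_operators])
  moreover have "cinner (?b (v i)) (v i) = of_real (\<bar>c i\<bar> powr p)" if "i < hdim" for i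
    using onfamD[OF v, of i i] that by (simp only: diagonal_apply[OF v that] cinner_scale_left) simp
  ultimately have "op_trace (op_powr (op_abs z) p) = (\<Sum>i<hdim. of_real (\<bar>c i\<bar> powr p))"
    by simp
  then show ?thesis by (simp add: schatten_norm_def)
qed

lemma schatten_pow_svd:
  assumes "svd z v u c" "0 < p"
  shows "schatten_pow p z = (\<Sum>i<hdim. \<bar>c i\<bar> powr p)"
proof -
  have "0 \<le> (\<Sum>i<hdim. \<bar>c i\<bar> powr p)" by (simp add: sum_nonneg)
  then show ?thesis
    using assms(2) by (simp add: schatten_pow_def schatten_norm_svd[OF assms(1)] powr_powr)
qed

lemma schatten_pow_adjoint:
  assumes "z \<in> operators" "0 < p"
  shows "schatten_pow p (op_adjoint z) = schatten_pow p z"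
proof -
  obtain v u c where "svd z v u c" using svd_exists[OF assms(1)] by metis
  then show ?thesis using schatten_pow_svd svd_adjoint assms(2) by metis
qed

subsection \<open>Bounds on the trace of powers\<close>

text \<open>Jensen's inequality for the convex function \<open>t \<mapsto> t\<^bsup>-p/2\<^esup>\<close> of the inverse squared
  singular values; in contrast to the usual pinching bounds it is valid for every \<open>p > 0\<close>.\<close>

lemma schatten_pow_ge_preimages:
  assumes z: "z \<in> operators" and J: "onfam J g" "finite J" and h: "\<And>j. j \<in> J \<Longrightarrow> z (h j) = g j"
    and p: "0 < p"
  shows "(\<Sum>j\<in>J. ((hnorm (h j))\<^sup>2) powr (- (p / 2))) \<le> schatten_pow p z"
proof -
  obtain v u c where s: "svd z v u c" and c: "\<And>i. 0 \<le> c i"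
    using svd_exists[OF z] by metis
  define A where "A = {k\<in>{..<hdim}. c k \<noteq> 0}"
  \<comment> \<open>The weights for Jensen's inequality. Each row sums to 1 over \<open>A\<close>
    because \<open>g j\<close>, being in the range of \<open>z\<close>, is orthogonal to the
    \<open>u k\<close> with \<open>c k = 0\<close>; each column sums to at most 1 by Bessel's
    inequality.\<close>
  define a where "a j k = (cmod (cinner (g j) (u k)))\<^sup>2" for j k
  have gu: "cinner (g j) (u k) = of_real (c k) * cinner (h j) (v k)" if "j \<in> J" "k < hdim" for j k
    using that by (simp add: op_adjoint_cinner[OF z] svd_adjoint_apply[OF s] cinner_scale_right
        flip: h)
  have A: "finite A" "A \<subseteq> {..<hdim}" by (auto simp: A_def)
  have pos: "0 < c k" if "k \<in> A" for k
    using that c[of k] by (simp add: A_def)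
  have suma: "(\<Sum>k\<in>A. a j k) = 1" if "j \<in> J" for j
  proof -
    have "(\<Sum>k\<in>A. a j k) = (\<Sum>k<hdim. a j k)"
      by (rule sum.mono_neutral_left) (use that in \<open>auto simp: A_def a_def gu\<close>)
    then show ?thesis
      using onb_hnorm[OF svdD(3)[OF s], of "g j"] onfam_hnorm[OF J(1) that] by (simp add: a_def)
  qed
  \<comment> \<open>An inequality only: the sum over \<open>A\<close> does not see the part of
    \<open>h j\<close> in the kernel of \<open>z\<close>.\<close>
  have le: "(\<Sum>k\<in>A. a j k * (1 / (c k)\<^sup>2)) \<le> (hnorm (h j))\<^sup>2" if "j \<in> J" for j
  proof -
    have "(\<Sum>k\<in>A. a j k * (1 / (c k)\<^sup>2)) = (\<Sum>k\<in>A. (cmod (cinner (h j) (v k)))\<^sup>2)"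
    proof (intro sum.cong refl)
      fix k assume "k \<in> A"
      then show "a j k * (1 / (c k)\<^sup>2) = (cmod (cinner (h j) (v k)))\<^sup>2"
        using that pos[of k] A(2) by (auto simp: a_def gu norm_mult power_mult_distrib)
    qed
    also have "\<dots> \<le> (\<Sum>k<hdim. (cmod (cinner (h j) (v k)))\<^sup>2)"
      by (intro sum_mono2) (use A in auto)
    finally show ?thesis
      by (simp add: onb_hnorm[OF svdD(2)[OF s]])
  qed
  have cp: "(1 / (c k)\<^sup>2) powr (- (p / 2)) = c k powr p" if "k \<in> A" for k
  proof -
    have "(1 / (c k)\<^sup>2) powr (- (p / 2)) = ((c k)\<^sup>2) powr (p / 2)"
      by (simp add: powr_minus powr_divide)
    also have "\<dots> = c k powr p"
      using pos[OF that] powr_powr[of "c k" 2 "p / 2"] by simp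
    finally show ?thesis .
  qed
  have "(\<Sum>j\<in>J. ((hnorm (h j))\<^sup>2) powr (- (p / 2))) \<le> (\<Sum>j\<in>J. \<Sum>k\<in>A. a j k * (1 / (c k)\<^sup>2) powr (- (p / 2)))"
    by (intro sum_mono jensen_powr_neg[OF A(1) _ suma _ le]) (use p in \<open>auto simp: a_def dest: pos\<close>)
  also have "\<dots> = (\<Sum>k\<in>A. (\<Sum>j\<in>J. a j k) * c k powr p)"
    by (subst sum.swap) (simp add: cp sum_distrib_right)
  also have "\<dots> \<le> (\<Sum>k\<in>A. 1 * c k powr p)"
  proof (intro sum_mono mult_right_mono)
    fix k assume "k \<in> A"
    then have "hnorm (u k) = 1" using onfam_hnorm[OF svdD(3)[OF s]] A(2) by auto
    moreover have "a j k = (cmod (cinner (u k) (g j)))\<^sup>2" for j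
      unfolding a_def by (metis cinner_commute complex_mod_cnj)
    ultimately show "(\<Sum>j\<in>J. a j k) \<le> 1"
      using bessel[OF J, of "u k"] by simp
  qed simp
  also have "\<dots> \<le> (\<Sum>k<hdim. c k powr p)"
    using A by (simp add: sum_mono2)
  also have "\<dots> = schatten_pow p z"
    using c by (simp add: schatten_pow_svd[OF s p])
  finally show ?thesis .
qed

text \<open>Reduces to preimages: \<open>h j\<close> divided by \<open>r j\<close> is mapped to
  \<open>g j\<close>. Indices with \<open>r j = 0\<close> contribute nothing, as
  \<open>0 powr p = 0\<close>.\<close>

lemma schatten_pow_ge_images:
  assumes z: "z \<in> operators" and J: "onfam J g" "finite J"
    and h: "\<And>j. j \<in> J \<Longrightarrow> z (h j) = of_real (r j) *\<^sub>C g j" "\<And>j. j \<in> J \<Longrightarrow> hnorm (h j) = 1"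
      "\<And>j. j \<in> J \<Longrightarrow> 0 \<le> r j"
    and p: "0 < p"
  shows "(\<Sum>j\<in>J. r j powr p) \<le> schatten_pow p z"
proof -
  define K where "K = {j\<in>J. r j \<noteq> 0}"
  let ?h = "\<lambda>j. of_real (1 / r j) *\<^sub>C h j"
  have "(\<Sum>j\<in>J. r j powr p) = (\<Sum>j\<in>K. r j powr p)"
    using J(2) by (intro sum.mono_neutral_right) (auto simp: K_def)
  also have "\<dots> = (\<Sum>j\<in>K. ((hnorm (?h j))\<^sup>2) powr (- (p / 2)))"
  proof (intro sum.cong refl)
    fix j assume j: "j \<in> K"
    then have r: "0 < r j" using h(3)[of j] by (auto simp: K_def)
    then have "hnorm (?h j) = 1 / r j"
      using j h(2)[of j] by (simp add: hnorm_scale K_def norm_divide)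
    then have "((hnorm (?h j))\<^sup>2) powr (- (p / 2)) = ((r j)\<^sup>2) powr (p / 2)"
      by (simp add: powr_minus powr_divide power_divide)
    also have "\<dots> = r j powr p"
      using r powr_powr[of "r j" 2 "p / 2"] by simp
    finally show "r j powr p = ((hnorm (?h j))\<^sup>2) powr (- (p / 2))" by simp
  qed
  also have "\<dots> \<le> schatten_pow p z"
  proof (rule schatten_pow_ge_preimages[OF z _ _ _ p])
    show "onfam K g" by (rule onfam_subset[OF J(1)]) (auto simp: K_def)
    show "finite K" using J(2) by (simp add: K_def)
    show "z (?h j) = g j" if "j \<in> K" for j
      using that by (simp add: K_def operators_scale[OF z] h(1))
  qed
  finally show ?thesis .
qed

text \<open>Compressing \<open>z\<close> to the span of the \<open>g\<close> does not increase the singular values.\<close>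

lemma schatten_pow_ge_biorthogonal:
  assumes z: "z \<in> operators" and J: "onfam J g" "finite J"
    and h: "\<And>j k. j \<in> J \<Longrightarrow> k \<in> J \<Longrightarrow> cinner (z (h j)) (g k) = (if j = k then 1 else 0)"
    and p: "0 < p"
  shows "(\<Sum>j\<in>J. ((hnorm (h j))\<^sup>2) powr (- (p / 2))) \<le> schatten_pow p z"
proof -
  define P where "P a = (\<Sum>j\<in>J. cinner a (g j) *\<^sub>C g j)" for a
  have P: "P \<in> operators"
    by (rule operatorsI)
      (simp_all add: P_def cinner_linear scale_left_distrib sum.distrib scale_sum_right)
  have sym: "cinner (P a) b = cinner a (P b)" for a b
    unfolding P_def cinner_sum_left cinner_sum_right cinner_scale_left cinner_scale_right
    by (intro sum.cong refl) (metis cinner_commute mult.commute)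
  have gP: "cinner (P a) (g j) = cinner a (g j)" if "j \<in> J" for a j
    unfolding P_def by (rule onfam_sum_cinner[OF J that])
  have PP: "P (P a) = P a" for a
    unfolding P_def[of "P a"] using gP by (simp add: P_def)
  have Pz: "P \<circ> z \<in> operators" by (intro operators_comp P z)
  have adj: "op_adjoint (P \<circ> z) = op_adjoint z \<circ> P"
    by (rule op_adjoint_unique) (simp add: sym op_adjoint_cinner[OF z])
  \<comment> \<open>\<open>P\<close> projects onto the span of the \<open>g j\<close>, so
    biorthogonality says that \<open>h j\<close> is a preimage of \<open>g j\<close> under
    \<open>P \<circ> z\<close>.\<close>
  have "(\<Sum>j\<in>J. ((hnorm (h j))\<^sup>2) powr (- (p / 2))) \<le> schatten_pow p (P \<circ> z)"
  proof (rule schatten_pow_ge_preimages[OF Pz J _ p])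
    fix j assume "j \<in> J"
    then have "P (z (h j)) = (\<Sum>k\<in>J. if k = j then g k else 0)"
      unfolding P_def by (intro sum.cong refl) (simp add: h)
    then show "(P \<circ> z) (h j) = g j" using J(2) \<open>j \<in> J\<close> by simp
  qed
  also have "\<dots> \<le> schatten_pow p (op_adjoint z)"
  proof -
    obtain v u c where s: "svd (P \<circ> z) v u c" and c: "\<And>i. 0 \<le> c i"
      using svd_exists[OF Pz] by metis
    let ?K = "{k\<in>{..<hdim}. c k \<noteq> 0}"
    \<comment> \<open>Left singular vectors of \<open>P \<circ> z\<close> with
      \<open>c k \<noteq> 0\<close> lie in the range of \<open>P\<close>, so the adjoint of
      \<open>z\<close> acts on them as the adjoint of \<open>P \<circ> z\<close> does and maps
      \<open>u k\<close> to \<open>c k\<close> times \<open>v k\<close>.\<close>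
    have Pu: "P (u k) = u k" if "k \<in> ?K" for k
    proof -
      have "P (of_real (c k) *\<^sub>C u k) = of_real (c k) *\<^sub>C u k"
        using svdD(4)[OF s, of k] that PP by (metis (mono_tags, lifting) lessThan_iff mem_Collect_eq o_apply)
      then show ?thesis using that by (simp add: operators_scale[OF P])
    qed
    have "schatten_pow p (P \<circ> z) = (\<Sum>k<hdim. c k powr p)"
      using c by (simp add: schatten_pow_svd[OF s p])
    also have "\<dots> = (\<Sum>k\<in>?K. c k powr p)"
      by (rule sum.mono_neutral_right) auto
    also have "\<dots> \<le> schatten_pow p (op_adjoint z)"
    proof (rule schatten_pow_ge_images[OF op_adjoint_operators[OF z] _ _ _ _ _ p])
      show "onfam ?K v" by (rule onfam_subset[OF svdD(2)[OF s]]) auto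
      show "op_adjoint z (u k) = of_real (c k) *\<^sub>C v k" if "k \<in> ?K" for k
        using svd_adjoint_apply[OF s, of k] that Pu[OF that] by (simp add: adj)
      show "hnorm (u k) = 1" if "k \<in> ?K" for k
        using onfam_hnorm[OF svdD(3)[OF s]] that by auto
    qed (use c in auto)
    finally show ?thesis .
  qed
  also have "\<dots> = schatten_pow p z"
    by (rule schatten_pow_adjoint[OF z p])
  finally show ?thesis .
qed

text \<open>The numbers \<open>a j k\<close> form a doubly stochastic matrix between
  \<open>v\<close> and the eigenvectors of \<open>op_adjoint z \<circ> z\<close>, and
  \<open>p \<le> 2 * real N\<close> makes the exponent at most 1, so the concave Jensen inequality
  applies to each row. The integer power is there because its entries are polynomials in the entries
  of \<open>op_adjoint z \<circ> z\<close>, which can be differentiated along a curve.\<close>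

lemma schatten_pow_le_powers:
  assumes z: "z \<in> operators" and v: "onb v" and p: "0 < p" "p \<le> 2 * real N"
  shows "schatten_pow p z \<le>
    (\<Sum>j<hdim. (Re (cinner (((op_adjoint z \<circ> z) ^^ N) (v j)) (v j))) powr (p / (2 * real N)))"
proof -
  obtain f g c where s: "svd z f g c"
    using svd_exists[OF z] by metis
  let ?m = "op_adjoint z \<circ> z"
  have N: "0 < N" using p by (cases N) auto
  have mop: "?m \<in> operators" by (intro operators_comp op_adjoint_operators z)
  have mf: "?m (f k) = of_real ((c k)\<^sup>2) *\<^sub>C f k" if "k < hdim" for k
    using that by (simp add: svdD(4)[OF s] svd_adjoint_apply[OF s]
        operators_scale[OF op_adjoint_operators[OF z]] power2_eq_square)
  have mNop: "?m ^^ M \<in> operators" for M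
  proof (induction M)
    case (Suc M)
    show ?case unfolding funpow.simps by (rule operators_comp[OF mop Suc])
  qed (auto intro: operatorsI)
  have mNf: "(?m ^^ M) (f k) = of_real ((c k) ^ (2 * M)) *\<^sub>C f k" if "k < hdim" for k M
  proof (induction M)
    case (Suc M)
    have "(?m ^^ Suc M) (f k) = ?m ((?m ^^ M) (f k))" by simp
    also have "\<dots> = of_real ((c k) ^ (2 * M)) *\<^sub>C of_real ((c k)\<^sup>2) *\<^sub>C f k"
      by (simp only: Suc operators_scale[OF mop] mf[OF that])
    also have "\<dots> = of_real ((c k) ^ (2 * Suc M)) *\<^sub>C f k"
      by (simp add: power_add power2_eq_square mult_ac)
    finally show ?case .
  qed simp
  define a where "a j k = (cmod (cinner (v j) (f k)))\<^sup>2" for j k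
  have quad: "Re (cinner ((?m ^^ N) w) w) = (\<Sum>k<hdim. (cmod (cinner w (f k)))\<^sup>2 * (c k) ^ (2 * N))" for w
  proof -
    have "cinner ((?m ^^ N) w) w = cinner ((?m ^^ N) (\<Sum>k<hdim. cinner w (f k) *\<^sub>C f k)) w"
      by (simp only: onb_expand[OF svdD(2)[OF s]])
    also have "\<dots> = (\<Sum>k<hdim. cinner w (f k) * (of_real ((c k) ^ (2 * N)) * cinner (f k) w))"
      unfolding operators_sum[OF mNop] operators_scale[OF mNop] cinner_sum_left cinner_scale_left
      by (intro sum.cong refl) (simp only: lessThan_iff mNf cinner_scale_left)
    also have "\<dots> = of_real (\<Sum>k<hdim. (cmod (cinner w (f k)))\<^sup>2 * (c k) ^ (2 * N))"
      unfolding of_real_sum of_real_mult complex_norm_square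
      by (intro sum.cong refl) (metis cinner_commute mult.assoc mult.commute)
    finally show ?thesis by simp
  qed
  have suma: "(\<Sum>k<hdim. a j k) = 1" if "j < hdim" for j
    using onb_hnorm[OF svdD(2)[OF s], of "v j"] onfam_hnorm[OF v, of j] that by (simp add: a_def)
  have suma': "(\<Sum>j<hdim. a j k) = 1" if "k < hdim" for k
  proof -
    have "a j k = (cmod (cinner (f k) (v j)))\<^sup>2" for j
      unfolding a_def by (metis cinner_commute complex_mod_cnj)
    then show ?thesis
      using onb_hnorm[OF v, of "f k"] onfam_hnorm[OF svdD(2)[OF s], of k] that by simp
  qed
  have cp: "((c k) ^ (2 * N)) powr (p / (2 * real N)) = \<bar>c k\<bar> powr p" for k
  proof -
    have "(c k) ^ (2 * N) = \<bar>c k\<bar> ^ (2 * N)" by (simp add: power_even_abs)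
    also have "\<dots> = \<bar>c k\<bar> powr (2 * real N)"
      using N by (cases "c k = 0") (auto simp flip: powr_realpow)
    finally show ?thesis using N by (simp add: powr_powr)
  qed
  have "schatten_pow p z = (\<Sum>k<hdim. (\<Sum>j<hdim. a j k) * \<bar>c k\<bar> powr p)"
    by (simp add: schatten_pow_svd[OF s p(1)] suma')
  also have "\<dots> = (\<Sum>j<hdim. \<Sum>k<hdim. a j k * ((c k) ^ (2 * N)) powr (p / (2 * real N)))"
    unfolding sum_distrib_right cp by (rule sum.swap)
  also have "\<dots> \<le> (\<Sum>j<hdim. (\<Sum>k<hdim. a j k * (c k) ^ (2 * N)) powr (p / (2 * real N)))"
    by (intro sum_mono jensen_powr suma) (use p N in \<open>auto simp: a_def\<close>)
  finally show ?thesis unfolding quad a_def .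
qed

section \<open>Trace norm and contractions\<close>

lemma hnorm_diff_sq: "(hnorm (a - b))\<^sup>2 = (hnorm a)\<^sup>2 + (hnorm b)\<^sup>2 - 2 * Re (cinner a b)"
proof -
  have "Re (cinner (a - b) (a - b)) = Re (cinner a a) + Re (cinner b b) - Re (cinner a b) - Re (cinner b a)"
    by (simp add: cinner_linear)
  moreover have "Re (cinner b a) = Re (cinner a b)"
    by (metis cinner_commute cnj.simps(1))
  ultimately show ?thesis by (simp add: cinner_self)
qed

lemma Re_cinner_le_1: "hnorm a \<le> 1 \<Longrightarrow> hnorm b = 1 \<Longrightarrow> Re (cinner a b) \<le> 1"
  using hnorm_diff_sq[of a b] power_le_one[of "hnorm a" 2] zero_le_power2[of "hnorm (a - b)"]
  by simp

lemma Re_cinner_eq_1: "hnorm a \<le> 1 \<Longrightarrow> hnorm b = 1 \<Longrightarrow> Re (cinner a b) = 1 \<Longrightarrow> a = b"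
  using hnorm_diff_sq[of a b] power_le_one[of "hnorm a" 2] zero_le_power2[of "hnorm (a - b)"]
  by (simp add: power_le_zero_eq)

text \<open>In singular bases the real part of the trace is the sum of
  \<open>c k * Re (cinner (T (u k)) (v k))\<close>, each term at most \<open>c k\<close>. Equality
  forces \<open>T (u k) = v k\<close> whenever \<open>c k \<noteq> 0\<close>, so
  \<open>T \<circ> z\<close> is diagonal in \<open>v\<close> with real entries, hence
  self-adjoint.\<close>

lemma trace_contraction:
  assumes z: "z \<in> operators" and T: "T \<in> operators" "\<And>a. hnorm (T a) \<le> hnorm a"
  shows trace_contraction_le: "Re (op_trace (T \<circ> z)) \<le> schatten_pow 1 z"
    and trace_contraction_eq: "Re (op_trace (T \<circ> z)) = schatten_pow 1 z \<Longrightarrow>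
      cinner (T (z a)) b = cinner a (T (z b))"
proof -
  obtain v u c where s: "svd z v u c" and c: "\<And>i. 0 \<le> c i"
    using svd_exists[OF z] by metis
  have tr: "op_trace (T \<circ> z) = (\<Sum>k<hdim. of_real (c k) * cinner (T (u k)) (v k))"
    by (simp add: onb_trace[OF svdD(2)[OF s] operators_comp[OF T(1) z]] svdD(4)[OF s]
        operators_scale[OF T(1)] cinner_scale_left)
  have n: "hnorm (T (u k)) \<le> 1" "hnorm (v k) = 1" if "k < hdim" for k
    using that onfam_hnorm[OF svdD(3)[OF s], of k] onfam_hnorm[OF svdD(2)[OF s], of k] T(2)[of "u k"]
    by auto
  have le: "c k * Re (cinner (T (u k)) (v k)) \<le> c k" if "k < hdim" for k
    using mult_left_mono[OF Re_cinner_le_1[OF n[OF that]] c[of k]] by simp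
  have N: "schatten_pow 1 z = (\<Sum>k<hdim. c k)"
    using c by (simp add: schatten_pow_svd[OF s])
  show "Re (op_trace (T \<circ> z)) \<le> schatten_pow 1 z"
    unfolding N tr Re_sum using le by (intro sum_mono) simp
  assume "Re (op_trace (T \<circ> z)) = schatten_pow 1 z"
  then have "(\<Sum>k<hdim. c k - c k * Re (cinner (T (u k)) (v k))) = 0"
    by (simp add: N tr sum_subtractf)
  then have "\<forall>k\<in>{..<hdim}. c k - c k * Re (cinner (T (u k)) (v k)) = 0"
    by (subst (asm) sum_nonneg_eq_0_iff) (use le in auto)
  then have eq: "c k = 0 \<or> T (u k) = v k" if "k < hdim" for k
    using that Re_cinner_eq_1[OF n[OF that]] by auto
  have Tz: "T (z (v k)) = of_real (c k) *\<^sub>C v k" if "k < hdim" for k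
    using eq[OF that] that by (auto simp: svdD(4)[OF s] operators_scale[OF T(1)] operators_0[OF T(1)])
  have "svd (T \<circ> z) v v c"
    using svdD(2)[OF s] Tz operators_comp[OF T(1) z] by (simp add: svd_def)
  then have "op_adjoint (T \<circ> z) = T \<circ> z"
    by (intro operators_ext_onb[OF svdD(2)[OF s]] op_adjoint_operators operators_comp T(1) z)
      (simp add: svd_adjoint_apply Tz)
  then show "cinner (T (z a)) b = cinner a (T (z b))"
    using op_adjoint_cinner[OF operators_comp[OF T(1) z], of a b] by simp
qed

subsection \<open>First-order conditions\<close>

lemma DERIV_hnorm_rotation:
  "((\<lambda>t. (hnorm (a + of_real (cos t - 1) *\<^sub>C b + of_real (sin t) *\<^sub>C c))\<^sup>2)
    has_real_derivative 2 * Re (cinner c a)) (at 0)"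
proof -
  have re: "Re (cinner v w) = Re (cinner w v)" for v w
    by (metis cinner_commute cnj.simps(1))
  have "(hnorm v)\<^sup>2 = Re (cinner v v)" for v
    by (simp add: cinner_self)
  then have *: "(hnorm (a + of_real (cos t - 1) *\<^sub>C b + of_real (sin t) *\<^sub>C c))\<^sup>2 =
      Re (cinner a a) + (cos t - 1)\<^sup>2 * Re (cinner b b) + (sin t)\<^sup>2 * Re (cinner c c) +
      2 * (cos t - 1) * Re (cinner b a) + 2 * sin t * Re (cinner c a) +
      2 * (cos t - 1) * sin t * Re (cinner b c)" for t
    by (simp add: cinner_linear re[of a b] re[of a c] re[of c b] power2_eq_square algebra_simps del: of_real_diff)
  show ?thesis unfolding * by (auto intro!: derivative_eq_intros)
qed

text \<open>A great circle of the unit sphere taken as a real sphere: by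
  \<open>hnorm_rotation\<close> only the real part of \<open>cinner \<zeta> \<eta>\<close> has to
  vanish, so \<zeta> may be \<open>\<i>\<close> times \<eta>.\<close>

definition rotation :: "'a \<Rightarrow> 'a \<Rightarrow> real \<Rightarrow> 'a" where
  "rotation \<eta> \<zeta> t = of_real (cos t) *\<^sub>C \<eta> + of_real (sin t) *\<^sub>C \<zeta>"

lemma rotation_0 [simp]: "rotation \<eta> \<zeta> 0 = \<eta>"
  by (simp add: rotation_def)

lemma hnorm_rotation:
  assumes "hnorm \<eta> = 1" "hnorm \<zeta> = 1" "Re (cinner \<zeta> \<eta>) = 0"
  shows "hnorm (rotation \<eta> \<zeta> t) = 1"
proof -
  have re: "Re (cinner \<eta> \<zeta>) = 0"
    by (metis assms(3) cinner_commute cnj.simps(1))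
  have "Re (cinner (rotation \<eta> \<zeta> t) (rotation \<eta> \<zeta> t)) =
      (cos t)\<^sup>2 * Re (cinner \<eta> \<eta>) + (sin t)\<^sup>2 * Re (cinner \<zeta> \<zeta>)"
    using assms re by (simp add: rotation_def cinner_linear power2_eq_square)
  also have "\<dots> = 1"
    using assms by (simp add: cinner_self)
  finally show ?thesis by (simp add: hnorm_def)
qed

text \<open>The majorant \<open>U\<close> comes from \<open>schatten_pow_le_powers\<close> in the
  basis \<open>v\<close>. At \<open>t = 0\<close> the operator is diagonal with respect to
  \<open>v\<close> and \<open>u\<close>, so the bound is exact there. The matrix of
  \<open>m t\<close> changes to first order only off the diagonal, because
  \<open>cinner \<zeta> (u i)\<close> is imaginary, and the same then holds for its powers.\<close>

lemma schatten_pow_rotation_upper: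
  assumes x: "svd x v u s" and i: "i < hdim" "0 \<le> s i" and p: "0 < p"
    and \<zeta>: "hnorm \<zeta> = 1" "Re (cinner \<zeta> (u i)) = 0"
  obtains U where "\<And>t. schatten_pow p (\<lambda>a. x a + rank_one (rotation (u i) \<zeta> t) (v i) a) \<le> U t"
    "U 0 = schatten_pow p (\<lambda>a. x a + rank_one (u i) (v i) a)" "(U has_real_derivative 0) (at 0)"
proof -
  define z where "z t = (\<lambda>a. x a + rank_one (rotation (u i) \<zeta> t) (v i) a)" for t
  define m where "m t = op_adjoint (z t) \<circ> z t" for t
  define N where "N = nat \<lceil>p\<rceil>"
  have N: "0 < N" "p \<le> 2 * real N" using p by (auto simp: N_def) linarith
  note v = svdD(2)[OF x] and u = svdD(3)[OF x]
  have zop: "z t \<in> operators" for t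
    unfolding z_def by (intro operators_plus rank_one_operators svdD(1)[OF x])
  have mop: "m t \<in> operators" for t
    unfolding m_def by (intro operators_comp op_adjoint_operators zop)
  define P where "P N t j k = cinner ((m t ^^ N) (v j)) (v k)" for N t j k
  \<comment> \<open>The matrix of \<open>m t\<close> in the basis \<open>v\<close>, written as a
    Gram matrix; \<open>P N\<close> is the matrix of the \<open>N\<close>-th power.\<close>
  define M where "M t j k = cinner (z t (v j)) (z t (v k))" for t j k
  define d where "d j = s j + (if j = i then 1 else 0)" for j
  define D where "D j k = (if k = i then of_real (s j) * cinner (u j) \<zeta> else 0) +
      (if j = i then of_real (s k) * cinner \<zeta> (u k) else 0)" for j k
  have zv: "z t (v j) = of_real (s j) *\<^sub>C u j + (if j = i then rotation (u i) \<zeta> t else 0)"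
    if "j < hdim" for t j
    using that i onfamD[OF v, of j i] by (simp add: z_def rank_one_def svdD(4)[OF x])
  have Pstep: "P (Suc N) t j k = (\<Sum>l<hdim. P N t j l * M t l k)" for N t j k
  proof -
    have "P (Suc N) t j k = cinner (m t (\<Sum>l<hdim. P N t j l *\<^sub>C v l)) (v k)"
      by (simp add: P_def onb_expand[OF v])
    then show ?thesis
      by (simp add: operators_sum[OF zop] operators_scale[OF zop] cinner_linear M_def m_def
          op_adjoint_cinner'[OF zop])
  qed
  have hr: "hnorm (rotation (u i) \<zeta> t) = 1" for t
    using hnorm_rotation[OF _ \<zeta>] onfam_hnorm[OF u] i by simp
  have M: "M t j k = (if j = k then of_real ((s j)\<^sup>2) else 0) +
      (if k = i then of_real (s j) * cinner (u j) (rotation (u i) \<zeta> t) else 0) +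
      (if j = i then of_real (s k) * cinner (rotation (u i) \<zeta> t) (u k) else 0) +
      (if j = i \<and> k = i then 1 else 0)" if "j < hdim" "k < hdim" for t j k
    using that onfamD[OF u, of j k] cinner_self[of "rotation (u i) \<zeta> t"]
    by (simp add: M_def zv cinner_linear hr power2_eq_square distrib_left)
  have r1: "((\<lambda>t. cinner (rotation (u i) \<zeta> t) w) has_vector_derivative cinner \<zeta> w) (at 0)" for w
    by (simp add: rotation_def cinner_linear has_vector_derivative_rotation)
  have r2: "((\<lambda>t. cinner w (rotation (u i) \<zeta> t)) has_vector_derivative cinner w \<zeta>) (at 0)" for w
    by (simp add: rotation_def cinner_linear has_vector_derivative_rotation)
  have MD: "((\<lambda>t. M t j k) has_vector_derivative D j k) (at 0)" if "j < hdim" "k < hdim" for j k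
  proof -
    have "((\<lambda>t. M t j k) has_vector_derivative 0 +
      (if k = i then of_real (s j) * cinner (u j) \<zeta> else 0) +
      (if j = i then of_real (s k) * cinner \<zeta> (u k) else 0) + 0) (at 0)"
      unfolding M[OF that]
      by (intro has_vector_derivative_add)
        (auto intro!: has_vector_derivative_mult_right r1 r2)
    then show ?thesis by (simp add: D_def)
  qed
  have Dii: "D j j = 0" if "j < hdim" for j
  proof -
    have "cinner (u i) \<zeta> + cinner \<zeta> (u i) = of_real (2 * Re (cinner \<zeta> (u i)))"
      by (subst cinner_commute[of "u i"]) (simp add: complex_eq_iff)
    then show ?thesis
      using \<zeta>(2) by (auto simp: D_def simp flip: distrib_left)
  qed
  have M0: "M 0 j k = (if j = k then of_real ((d j)\<^sup>2) else 0)" if "j < hdim" "k < hdim" for j k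
    using that i onfamD[OF u, of j k] by (auto simp: M d_def onfamD[OF u] power2_eq_square algebra_simps)
  have PN: "\<And>j k. j < hdim \<Longrightarrow> k < hdim \<Longrightarrow> P N 0 j k = (if j = k then of_real ((d j)\<^sup>2) ^ N else 0)"
    and "\<exists>E. \<forall>j<hdim. E j j = 0 \<and> (\<forall>k<hdim. ((\<lambda>t. P N t j k) has_vector_derivative E j k) (at 0))" for N
    using power_of_diagonal_derivative[of hdim M "\<lambda>j. of_real ((d j)\<^sup>2)" D P N, OF M0 MD Dii]
      onfamD[OF v] Pstep by (auto simp: P_def)
  then obtain E where E: "\<And>j. j < hdim \<Longrightarrow> E j j = 0"
      "\<And>j k. j < hdim \<Longrightarrow> k < hdim \<Longrightarrow> ((\<lambda>t. P N t j k) has_vector_derivative E j k) (at 0)"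
    by metis
  define U where "U t = (\<Sum>j<hdim. (Re (P N t j j)) powr (p / (2 * real N)))" for t
  have "schatten_pow p (z t) \<le> U t" for t
    using schatten_pow_le_powers[OF zop v p N(2)] unfolding U_def P_def m_def .
  moreover have "U 0 = schatten_pow p (z 0)"
  proof -
    have "svd (z 0) v u d"
      using zop[of 0] v u by (auto simp: svd_def zv d_def scale_left_distrib)
    moreover have "((d j)\<^sup>2 ^ N) powr (p / (2 * real N)) = \<bar>d j\<bar> powr p" for j
    proof -
      have "(d j)\<^sup>2 ^ N = \<bar>d j\<bar> ^ (2 * N)" by (simp add: power_even_abs power_mult)
      also have "\<dots> = \<bar>d j\<bar> powr (2 * real N)"
        using N by (cases "d j = 0") (auto simp flip: powr_realpow)
      finally show ?thesis using N by (simp add: powr_powr)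
    qed
    moreover have "Re (P N 0 j j) = (d j)\<^sup>2 ^ N" if "j < hdim" for j
      using PN[OF that that, of N] by (simp flip: of_real_power)
    ultimately show ?thesis
      by (simp add: schatten_pow_svd[OF _ p] U_def)
  qed
  moreover have "(U has_real_derivative 0) (at 0)"
  proof -
    have "((\<lambda>t. (Re (P N t j j)) powr (p / (2 * real N))) has_real_derivative 0) (at 0)" if "j < hdim" for j
    proof (cases "d j = 0")
      case False
      have "((\<lambda>t. Re (P N t j j)) has_real_derivative Re (E j j)) (at 0)"
        unfolding has_real_derivative_iff_has_vector_derivative
        by (rule bounded_linear.has_vector_derivative[OF bounded_linear_Re E(2)[OF that that]])
      then have 1: "((\<lambda>t. Re (P N t j j)) has_real_derivative 0) (at 0)"
        by (simp add: E(1)[OF that])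
      have "Re (P N 0 j j) = (d j)\<^sup>2 ^ N"
        using PN[OF that that, of N] by (simp flip: of_real_power)
      then have "0 < Re (P N 0 j j)" using False by simp
      then show ?thesis using DERIV_fun_powr[OF 1, of "p / (2 * real N)"] by simp
    next
      case True
      \<comment> \<open>The outer power need not be differentiable at 0, but \<open>d j = 0\<close>
        excludes \<open>j = i\<close>, as \<open>s i + 1 > 0\<close>. Then \<open>z t\<close> kills
        \<open>v j\<close> for all \<open>t\<close>, and the entry is constantly 0.\<close>
      then have "j \<noteq> i" "s j = 0" using i by (auto simp: d_def split: if_splits)
      then have mv: "m t (v j) = 0" for t
        by (simp add: m_def zv that operators_0[OF op_adjoint_operators[OF zop]])
      obtain N' where N': "N = Suc N'" using N(1) by (cases N) auto
      have "(m t ^^ k) 0 = 0" for t k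
        by (induction k) (simp_all add: operators_0[OF mop])
      then have "P N t j j = 0" for t
        by (simp add: P_def N' funpow_Suc_right mv del: funpow.simps)
      then show ?thesis by simp
    qed
    then have "(U has_real_derivative (\<Sum>j<hdim. 0)) (at 0)"
      unfolding U_def by (intro DERIV_sum) auto
    then show ?thesis by simp
  qed
  ultimately show ?thesis using that[of U] by (simp add: z_def)
qed

text \<open>The biorthogonal family \<open>h\<close> in the proof comes from the Sherman--Morrison formula, multiplied by
  its denominator \<open>den\<close>.\<close>

lemma schatten_pow_rotation_lower:
  assumes y: "y \<in> operators" and z: "svd (\<lambda>a. y a + rank_one \<eta> \<xi> a) f g \<sigma>" "\<And>k. 0 \<le> \<sigma> k"
    and p: "0 < p"
  obtains L where
    "\<forall>\<^sub>F t in at 0. L t \<le> schatten_pow p (\<lambda>a. y a + rank_one (rotation \<eta> \<zeta> t) \<xi> a)"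
    "L 0 = schatten_pow p (\<lambda>a. y a + rank_one \<eta> \<xi> a)"
    "(L has_real_derivative p * (\<Sum>k<hdim. \<sigma> k powr (p - 1) * Re (cinner (f k) \<xi> * cinner \<zeta> (g k)))) (at 0)"
proof -
  define z where "z = (\<lambda>a. y a + rank_one \<eta> \<xi> a)"
  \<comment> \<open>Restricting to nonzero singular values loses nothing at \<open>t = 0\<close> and
    keeps the powers differentiable there; whatever the zero singular values become for other
    \<open>t\<close>, a lower bound may ignore it.\<close>
  define K where "K = {k\<in>{..<hdim}. \<sigma> k \<noteq> 0}"
  have K: "finite K" "K \<subseteq> {..<hdim}" "\<And>k. k \<in> K \<Longrightarrow> 0 < \<sigma> k" "\<And>k. k \<in> K \<Longrightarrow> k < hdim"
    using assms(3) by (auto simp: K_def less_le)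
  have s: "svd z f g \<sigma>" using assms(2) by (simp add: z_def)
  note zop = svdD(1)[OF s] and onf = svdD(2)[OF s] and ong = svdD(3)[OF s]
  have ongK: "onfam K g" by (rule onfam_subset[OF ong K(2)])
  \<comment> \<open>The pseudoinverse of \<open>z\<close>: it inverts \<open>z\<close> only up to
    the projection onto the \<open>g j\<close> with \<open>j \<in> K\<close>, which is all that
    biorthogonality asks.\<close>
  define R where "R a = (\<Sum>l\<in>K. (cinner a (g l) / of_real (\<sigma> l)) *\<^sub>C f l)" for a
  have zR: "cinner (z (R a)) (g j) = cinner a (g j)" if "j \<in> K" for a j
  proof -
    have "z (R a) = (\<Sum>l\<in>K. cinner a (g l) *\<^sub>C g l)"
      unfolding R_def operators_sum[OF zop] operators_scale[OF zop]
      by (intro sum.cong refl) (auto simp: svdD(4)[OF s] K(4) dest: K(3))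
    then show ?thesis using onfam_sum_cinner[OF ongK K(1) that] by simp
  qed
  have Rf: "cinner (R a) (f j) = cinner a (g j) / of_real (\<sigma> j)" if "j \<in> K" for a j
    unfolding R_def by (rule onfam_sum_cinner[OF onfam_subset[OF onf K(2)] K(1) that])
  define A where "A = R \<eta>"
  define B where "B = R \<zeta>"
  define \<phi> where "\<phi> k = cinner (f k) \<xi>" for k
  define den where "den t = 1 + of_real (cos t - 1) * cinner A \<xi> + of_real (sin t) * cinner B \<xi>" for t
  \<comment> \<open>If \<open>z\<close> is invertible, \<open>zz t\<close> maps this vector to
    \<open>of_real (\<sigma> k) * den t\<close> times \<open>g k\<close>; in general that holds
    after pairing with the \<open>g j\<close>, \<open>j \<in> K\<close>.\<close>
  define h where "h t k = f k + of_real (cos t - 1) *\<^sub>C (cinner A \<xi> *\<^sub>C f k - \<phi> k *\<^sub>C A) +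
      of_real (sin t) *\<^sub>C (cinner B \<xi> *\<^sub>C f k - \<phi> k *\<^sub>C B)" for t k
  define r where "r t k = (hnorm (h t k))\<^sup>2 / ((cmod (den t))\<^sup>2 * (\<sigma> k)\<^sup>2)" for t k
  define L where "L t = (\<Sum>k\<in>K. r t k powr (- (p / 2)))" for t
  define zz where "zz t = (\<lambda>a. y a + rank_one (rotation \<eta> \<zeta> t) \<xi> a)" for t
  have zzop: "zz t \<in> operators" for t
    unfolding zz_def by (intro operators_plus rank_one_operators y)
  define \<delta> where "\<delta> t = of_real (cos t - 1) *\<^sub>C \<eta> + of_real (sin t) *\<^sub>C \<zeta>" for t
  have zz: "zz t a = z a + cinner a \<xi> *\<^sub>C \<delta> t" for t a
    by (simp add: zz_def z_def rank_one_def rotation_def \<delta>_def scale_right_distrib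
        scale_left_diff_distrib scale_right_diff_distrib)
  have zh: "cinner (zz t (h t k)) (g j) = (if k = j then of_real (\<sigma> k) * den t else 0)"
    if "k \<in> K" "j \<in> K" for t k j
  proof -
    have fk: "cinner (z (f k)) (g j) = (if k = j then of_real (\<sigma> k) else 0)"
      using that K onfamD[OF ongK that] by (simp add: svdD(4)[OF s] cinner_linear)
    have hxi: "cinner (h t k) \<xi> = \<phi> k"
      by (simp add: h_def cinner_linear \<phi>_def)
    have "cinner (z (h t k)) (g j) = cinner (z (f k)) (g j) * den t - \<phi> k * cinner (\<delta> t) (g j)"
      unfolding h_def operators_add[OF zop] operators_scale[OF zop] operators_diff[OF zop]
        cinner_linear A_def[symmetric] B_def[symmetric]
      using zR[OF that(2), of \<eta>] zR[OF that(2), of \<zeta>]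
      by (simp add: den_def \<delta>_def cinner_linear A_def[symmetric] B_def[symmetric] algebra_simps)
    then show ?thesis
      by (simp add: zz cinner_linear hxi fk)
  qed
  have dd: "((\<lambda>t. (cmod (den t))\<^sup>2) has_real_derivative 2 * Re (cinner B \<xi>)) (at 0)"
    unfolding den_def by (rule DERIV_cmod_rotation)
  have d0: "den 0 = 1" by (simp add: den_def)
  have "((\<lambda>t. (cmod (den t))\<^sup>2) \<longlongrightarrow> (cmod (den 0))\<^sup>2) (at 0)"
    using DERIV_isCont[OF dd] by (simp add: isCont_def)
  then have "\<forall>\<^sub>F t in at 0. (cmod (den t))\<^sup>2 \<noteq> 0"
    by (rule tendsto_imp_eventually_ne) (simp add: d0)
  then have "\<forall>\<^sub>F t in at 0. L t \<le> schatten_pow p (zz t)"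
  proof eventually_elim
    case (elim t)
    then have den: "den t \<noteq> 0" by simp
    let ?h = "\<lambda>k. (1 / (of_real (\<sigma> k) * den t)) *\<^sub>C h t k"
    have "(hnorm (?h k))\<^sup>2 = r t k" for k
      by (simp add: hnorm_scale r_def norm_divide norm_mult power_divide power_mult_distrib mult.commute)
    moreover have "(\<Sum>k\<in>K. ((hnorm (?h k))\<^sup>2) powr (- (p / 2))) \<le> schatten_pow p (zz t)"
    proof (rule schatten_pow_ge_biorthogonal[OF zzop ongK K(1) _ p])
      fix k j assume kj: "k \<in> K" "j \<in> K"
      then show "cinner (zz t (?h k)) (g j) = (if k = j then 1 else 0)"
        using den K(3)[OF kj(1)] K(3)[OF kj(2)] zh[OF kj, of t]
        by (simp add: operators_scale[OF zzop] cinner_scale_left)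
    qed
    ultimately show ?case by (simp add: L_def)
  qed
  moreover have r0: "r 0 k = 1 / (\<sigma> k)\<^sup>2" if "k \<in> K" for k
    using onfam_hnorm[OF onf, of k] K(4)[OF that] by (simp add: r_def h_def d0)
  have sp: "(1 / (\<sigma> k)\<^sup>2) powr (- q) = \<sigma> k powr (2 * q)" if "k \<in> K" for k q
  proof -
    have "(1 / (\<sigma> k)\<^sup>2) powr (- q) = ((\<sigma> k)\<^sup>2) powr q"
      by (simp add: powr_minus powr_divide)
    also have "\<dots> = \<sigma> k powr (2 * q)"
      using K(3)[OF that] powr_powr[of "\<sigma> k" 2 q] by simp
    finally show ?thesis .
  qed
  have "L 0 = schatten_pow p z"
  proof -
    have "L 0 = (\<Sum>k\<in>K. \<sigma> k powr p)"
      unfolding L_def using sp[of _ "p / 2"] by (intro sum.cong refl) (simp add: r0)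
    also have "\<dots> = (\<Sum>k<hdim. \<sigma> k powr p)"
      by (rule sum.mono_neutral_left) (auto simp: K_def)
    finally show ?thesis
      using assms(3) by (simp add: schatten_pow_svd[OF s p])
  qed
  moreover have "(L has_real_derivative p * (\<Sum>k<hdim. \<sigma> k powr (p - 1) * Re (\<phi> k * cinner \<zeta> (g k)))) (at 0)"
  proof -
    have "((\<lambda>t. r t k powr (- (p / 2))) has_real_derivative p * (\<sigma> k powr (p - 1) * Re (\<phi> k * cinner \<zeta> (g k)))) (at 0)"
      if "k \<in> K" for k
    proof -
      note \<sigma> = K(3)[OF that]
      define X where "X = Re (\<phi> k * cinner \<zeta> (g k))"
      have "cinner (f k) (f k) = 1" using onfamD[OF onf, of k k] K(4)[OF that] by simp
      then have "Re (cinner (cinner B \<xi> *\<^sub>C f k - \<phi> k *\<^sub>C B) (f k)) =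
          Re (cinner B \<xi>) - X / \<sigma> k"
        using \<sigma> by (simp add: cinner_linear B_def Rf[OF that] Re_divide_of_real X_def)
      then have hd: "((\<lambda>t. (hnorm (h t k))\<^sup>2) has_real_derivative
          2 * (Re (cinner B \<xi>) - X / \<sigma> k)) (at 0)"
        unfolding h_def using DERIV_hnorm_rotation[of "f k" "cinner A \<xi> *\<^sub>C f k - \<phi> k *\<^sub>C A" "cinner B \<xi> *\<^sub>C f k - \<phi> k *\<^sub>C B"] by simp
      have h0: "hnorm (h 0 k) = 1"
        using onfam_hnorm[OF onf, of k] K(4)[OF that] by (simp add: h_def)
      \<comment> \<open>In the quotient the contributions of \<open>Re (cinner B \<xi>)\<close> from
        numerator and denominator cancel.\<close>
      have "((\<lambda>t. (hnorm (h t k))\<^sup>2 / (cmod (den t))\<^sup>2) has_real_derivative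
          - 2 * X / \<sigma> k) (at 0)"
        using DERIV_divide[OF hd dd] by (simp add: h0 d0)
      from DERIV_cdivide[OF this, of "(\<sigma> k)\<^sup>2"]
      have rd: "((\<lambda>t. r t k) has_real_derivative - 2 * X / \<sigma> k / (\<sigma> k)\<^sup>2) (at 0)"
        by (simp add: r_def)
      have r0': "0 < r 0 k" using \<sigma> by (simp add: r0[OF that])
      have pw: "r 0 k powr (- (p / 2) - 1) = \<sigma> k powr (p - 1) * \<sigma> k * (\<sigma> k)\<^sup>2"
      proof -
        have "r 0 k powr (- (p / 2) - 1) = \<sigma> k powr (2 * (p / 2 + 1))"
          using sp[OF that, of "p / 2 + 1"] by (simp add: r0[OF that])
        also have "2 * (p / 2 + 1) = (p - 1) + 1 + 2" by simp
        also have "\<sigma> k powr ((p - 1) + 1 + 2) = \<sigma> k powr (p - 1) * \<sigma> k powr 1 * \<sigma> k powr 2"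
          by (simp only: powr_add)
        finally show ?thesis using \<sigma> by simp
      qed
      have "((\<lambda>t. r t k powr (- (p / 2))) has_real_derivative
          (- (p / 2)) * r 0 k powr (- (p / 2) - 1) * (- 2 * X / \<sigma> k / (\<sigma> k)\<^sup>2)) (at 0)"
        using DERIV_fun_powr[OF rd r0', of "- (p / 2)"] by simp
      then show ?thesis
        unfolding pw X_def[symmetric] using \<sigma> by (simp add: field_simps)
    qed
    then have "(L has_real_derivative (\<Sum>k\<in>K. p * (\<sigma> k powr (p - 1) * Re (\<phi> k * cinner \<zeta> (g k))))) (at 0)"
      unfolding L_def by (intro DERIV_sum) auto
    also have "(\<Sum>k\<in>K. p * (\<sigma> k powr (p - 1) * Re (\<phi> k * cinner \<zeta> (g k)))) =
        (\<Sum>k<hdim. p * (\<sigma> k powr (p - 1) * Re (\<phi> k * cinner \<zeta> (g k))))"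
      by (rule sum.mono_neutral_left) (auto simp: K_def)
    finally show ?thesis by (simp add: sum_distrib_left)
  qed
  ultimately show ?thesis using that[of L] by (simp add: z_def zz_def \<phi>_def)
qed

text \<open>\<open>U - L\<close> has a local minimum at 0 along every admissible rotation, so the
  derivative of \<open>L\<close> vanishes: \<open>w\<close> is orthogonal, in the real sense, to
  every direction tangent to the sphere at \<open>u i\<close>. It is therefore a real multiple of
  \<open>u i\<close>, and the claim compares coordinates in \<open>g\<close>.\<close>

lemma rotation_critical:
  assumes x: "svd x v u s" and i: "i < hdim" "0 \<le> s i" and p: "0 < p" and y: "y \<in> operators"
    and eq: "\<And>\<eta>. hnorm \<eta> = 1 \<Longrightarrow>
      schatten_pow p (\<lambda>a. x a + rank_one \<eta> (v i) a) = schatten_pow p (\<lambda>a. y a + rank_one \<eta> (v i) a)"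
    and z: "svd (\<lambda>a. y a + rank_one (u i) (v i) a) f g \<sigma>" "\<And>k. 0 \<le> \<sigma> k"
  obtains l :: real where
    "\<And>k. k < hdim \<Longrightarrow> of_real (\<sigma> k powr (p - 1)) * cinner (v i) (f k) = of_real l * cinner (u i) (g k)"
proof -
  \<comment> \<open>The gradient: \<open>z\<close> times the power \<open>p - 2\<close> of its
    absolute value, applied to \<open>v i\<close>, with value 0 on the kernel of
    \<open>z\<close>.\<close>
  define w where "w = (\<Sum>k<hdim. (of_real (\<sigma> k powr (p - 1)) * cinner (v i) (f k)) *\<^sub>C g k)"
  have ui: "hnorm (u i) = 1" using onfam_hnorm[OF svdD(3)[OF x]] i by simp
  have crit: "Re (cinner \<zeta> w) = 0" if \<zeta>: "hnorm \<zeta> = 1" "Re (cinner \<zeta> (u i)) = 0" for \<zeta>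
  proof -
    let ?F = "\<lambda>t. schatten_pow p (\<lambda>a. y a + rank_one (rotation (u i) \<zeta> t) (v i) a)"
    let ?d = "p * (\<Sum>k<hdim. \<sigma> k powr (p - 1) * Re (cinner (f k) (v i) * cinner \<zeta> (g k)))"
    obtain U where U: "\<And>t. schatten_pow p (\<lambda>a. x a + rank_one (rotation (u i) \<zeta> t) (v i) a) \<le> U t"
      "U 0 = schatten_pow p (\<lambda>a. x a + rank_one (u i) (v i) a)" "(U has_real_derivative 0) (at 0)"
      by (rule schatten_pow_rotation_upper[OF x i p \<zeta>]) blast
    obtain L where L: "\<forall>\<^sub>F t in at 0. L t \<le> ?F t"
        "L 0 = schatten_pow p (\<lambda>a. y a + rank_one (u i) (v i) a)" "(L has_real_derivative ?d) (at 0)"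
      by (rule schatten_pow_rotation_lower[OF y z p]) blast
    have F: "?F t \<le> U t" for t
      using U(1)[of t] eq[OF hnorm_rotation[OF ui \<zeta>, of t]] by simp
    have "\<forall>\<^sub>F t in at 0. U 0 - L 0 \<le> U t - L t"
      using L(1)
    proof eventually_elim
      case (elim t)
      then show ?case using F[of t] U(2) L(2) eq[OF ui] by simp
    qed
    then obtain e where e: "0 < e" "\<And>t. t \<noteq> 0 \<Longrightarrow> \<bar>t\<bar> < e \<Longrightarrow> U 0 - L 0 \<le> U t - L t"
      by (auto simp: eventually_at dist_real_def)
    have "0 - ?d = 0"
    proof (rule DERIV_local_min[OF DERIV_diff[OF U(3) L(3)] e(1)], intro allI impI)
      fix t :: real assume "\<bar>0 - t\<bar> < e"
      then show "U 0 - L 0 \<le> U t - L t" using e(2)[of t] by (cases "t = 0") auto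
    qed
    then have "(\<Sum>k<hdim. \<sigma> k powr (p - 1) * Re (cinner (f k) (v i) * cinner \<zeta> (g k))) = 0"
      using p by simp
    moreover have "cinner \<zeta> w = (\<Sum>k<hdim. of_real (\<sigma> k powr (p - 1)) * (cinner (f k) (v i) * cinner \<zeta> (g k)))"
      unfolding w_def cinner_sum_right cinner_scale_right
      by (intro sum.cong refl) (simp add: cinner_commute[of "f _" "v i"])
    ultimately show ?thesis by simp
  qed
  define l where "l = Re (cinner w (u i))"
  \<comment> \<open>The tangential part of \<open>w\<close>; normalized, it is itself an admissible
    direction, and testing with it shows that it is 0.\<close>
  define \<zeta> where "\<zeta> = w - of_real l *\<^sub>C u i"
  have orth: "Re (cinner \<zeta> (u i)) = 0"
    using ui by (simp add: \<zeta>_def cinner_linear cinner_self l_def)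
  have "\<zeta> = 0"
  proof (rule ccontr)
    assume nz: "\<zeta> \<noteq> 0"
    have "Re (cinner (of_real (1 / hnorm \<zeta>) *\<^sub>C \<zeta>) w) = 0"
      by (rule crit[OF hnorm_normalize[OF nz]])
        (simp add: cinner_scale_left orth del: of_real_divide)
    then have "Re (cinner \<zeta> w) = 0"
      using nz by (simp add: cinner_scale_left del: of_real_divide)
    moreover have "cinner \<zeta> w = cinner \<zeta> \<zeta> + of_real l * cinner \<zeta> (u i)"
      by (simp add: \<zeta>_def cinner_linear)
    ultimately have "Re (cinner \<zeta> \<zeta>) = 0" using orth by simp
    then show False using nz cinner_pos[OF nz] by simp
  qed
  then have w: "w = of_real l *\<^sub>C u i" by (simp add: \<zeta>_def)
  have "of_real (\<sigma> k powr (p - 1)) * cinner (v i) (f k) = of_real l * cinner (u i) (g k)" if "k < hdim" for k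
  proof -
    have "cinner w (g k) = of_real (\<sigma> k powr (p - 1)) * cinner (v i) (f k)"
      unfolding w_def by (rule onfam_sum_cinner[OF svdD(3)[OF z(1)]]) (use that in auto)
    then show ?thesis by (simp add: w cinner_scale_left)
  qed
  then show ?thesis using that by blast
qed

subsection \<open>Transfer of singular pairs\<close>

lemma schatten_pow_add_singular_pair:
  assumes y: "svd y v u c" and i: "i < hdim" and p: "0 < p"
  shows "schatten_pow p (\<lambda>a. y a + rank_one (of_real \<kappa> *\<^sub>C u i) (v i) a) =
    schatten_pow p y - \<bar>c i\<bar> powr p + \<bar>c i + \<kappa>\<bar> powr p"
proof -
  have "svd (\<lambda>a. y a + rank_one (of_real \<kappa> *\<^sub>C u i) (v i) a) v u (c(i := c i + \<kappa>))"
    unfolding svd_def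
  proof (intro conjI allI impI operators_plus rank_one_operators svdD(1-3)[OF y])
    fix j assume "j < hdim"
    then show "y (v j) + rank_one (of_real \<kappa> *\<^sub>C u i) (v i) (v j) = of_real ((c(i := c i + \<kappa>)) j) *\<^sub>C u j"
      using i onfamD[OF svdD(2)[OF y], of j i]
      by (simp add: svdD(4)[OF y] rank_one_def scale_left_distrib)
  qed
  then have "schatten_pow p (\<lambda>a. y a + rank_one (of_real \<kappa> *\<^sub>C u i) (v i) a) =
      (\<Sum>j<hdim. \<bar>(c(i := c i + \<kappa>)) j\<bar> powr p)"
    by (rule schatten_pow_svd[OF _ p])
  also have "\<dots> = \<bar>c i + \<kappa>\<bar> powr p + (\<Sum>j\<in>{..<hdim} - {i}. \<bar>c j\<bar> powr p)"
    using i by (subst sum.remove[of _ i]) auto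
  also have "(\<Sum>j\<in>{..<hdim} - {i}. \<bar>c j\<bar> powr p) = schatten_pow p y - \<bar>c i\<bar> powr p"
    using i by (simp add: schatten_pow_svd[OF y p] sum.remove[of "{..<hdim}" i])
  finally show ?thesis by simp
qed

lemma svd_coeff_le_1:
  assumes "svd y v u c" "i < hdim" "0 < p" "schatten_pow p y \<le> 1"
  shows "\<bar>c i\<bar> \<le> 1"
proof (rule ccontr)
  assume "\<not> ?thesis"
  then have "1 < \<bar>c i\<bar> powr p" using assms(3) powr_less_mono2[of p 1 "\<bar>c i\<bar>"] by simp
  also have "\<dots> \<le> (\<Sum>j<hdim. \<bar>c j\<bar> powr p)"
    using assms(2) by (intro member_le_sum) auto
  also have "\<dots> \<le> 1" using assms schatten_pow_svd by metis
  finally show False by simp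
qed

lemma singular_pair_transfer:
  assumes x: "svd x v u s" and i: "i < hdim" "0 \<le> s i" and y: "y \<in> operators"
    and p: "0 < p" "p \<noteq> 1" and nx: "schatten_pow p x = 1" "schatten_pow p y = 1"
    and eq: "\<And>\<eta> \<xi>. hnorm \<eta> = 1 \<Longrightarrow> hnorm \<xi> = 1 \<Longrightarrow>
      schatten_pow p (\<lambda>a. x a + rank_one \<eta> \<xi> a) = schatten_pow p (\<lambda>a. y a + rank_one \<eta> \<xi> a)"
  shows "y (v i) = of_real (s i) *\<^sub>C u i"
proof -
  define z where "z = (\<lambda>a. y a + rank_one (u i) (v i) a)"
  have zop: "z \<in> operators" unfolding z_def by (intro operators_plus y rank_one_operators)
  have xop: "x \<in> operators" using svdD(1)[OF x] .
  have vi: "hnorm (v i) = 1" and ui: "hnorm (u i) = 1"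
    using onfam_hnorm[OF svdD(2)[OF x]] onfam_hnorm[OF svdD(3)[OF x]] i by auto
  obtain f g \<sigma> where s: "svd z f g \<sigma>" and \<sigma>: "\<And>k. 0 \<le> \<sigma> k"
    using svd_exists[OF zop] by metis
  have adj: "op_adjoint z = (\<lambda>a. op_adjoint y a + rank_one (v i) (u i) a)"
    unfolding z_def by (simp add: op_adjoint_plus[OF y rank_one_operators] op_adjoint_rank_one)
  obtain l :: real where l: "\<And>k. k < hdim \<Longrightarrow>
      of_real (\<sigma> k powr (p - 1)) * cinner (v i) (f k) = of_real l * cinner (u i) (g k)"
    by (rule rotation_critical[OF x i p(1) y eq[OF _ vi] s[unfolded z_def] \<sigma>]) blast+
  \<comment> \<open>The adjoint preserves \<open>schatten_pow\<close> and swaps the two unit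
    vectors, so varying the right vector at \<open>x\<close> becomes varying the left one at the
    adjoint.\<close>
  have eq': "schatten_pow p (\<lambda>a. op_adjoint x a + rank_one \<eta> (u i) a) =
      schatten_pow p (\<lambda>a. op_adjoint y a + rank_one \<eta> (u i) a)" if "hnorm \<eta> = 1" for \<eta>
  proof -
    have "schatten_pow p (\<lambda>a. op_adjoint w a + rank_one \<eta> (u i) a) =
        schatten_pow p (\<lambda>a. w a + rank_one (u i) \<eta> a)" if "w \<in> operators" for w
      using schatten_pow_adjoint[OF operators_plus[OF that rank_one_operators[of "u i" \<eta>]] p(1)]
      by (simp add: op_adjoint_plus[OF that rank_one_operators] op_adjoint_rank_one)
    then show ?thesis using eq[OF ui that] xop y by simp
  qed
  obtain l' :: real where l': "\<And>k. k < hdim \<Longrightarrow>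
      of_real (\<sigma> k powr (p - 1)) * cinner (u i) (g k) = of_real l' * cinner (v i) (f k)"
    by (rule rotation_critical[OF svd_adjoint[OF x] i p(1) op_adjoint_operators[OF y] eq'
          svd_adjoint[OF s, unfolded adj] \<sigma>]) blast+
  have \<alpha>: "(\<Sum>k<hdim. (cmod (cinner (v i) (f k)))\<^sup>2) = 1"
    and \<beta>: "(\<Sum>k<hdim. (cmod (cinner (u i) (g k)))\<^sup>2) = 1"
    using onb_hnorm[OF svdD(2)[OF s], of "v i"] onb_hnorm[OF svdD(3)[OF s], of "u i"] vi ui by auto
  obtain \<mu> :: real where
    \<mu>: "\<And>k. k < hdim \<Longrightarrow> of_real (\<sigma> k) * cinner (v i) (f k) = of_real \<mu> * cinner (u i) (g k)"
      "\<And>k. k < hdim \<Longrightarrow> of_real (\<sigma> k) * cinner (u i) (g k) = of_real \<mu> * cinner (v i) (f k)"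
    by (rule proportional_coordinates[where \<sigma> = \<sigma>, OF \<sigma> p(2) \<alpha> \<beta> l l']) blast+
  have "z (v i) = of_real \<mu> *\<^sub>C u i"
    by (rule onb_ext[OF svdD(3)[OF s]])
      (simp add: op_adjoint_cinner[OF zop] svd_adjoint_apply[OF s] cinner_linear \<mu>)
  then have yv: "y (v i) = of_real (\<mu> - 1) *\<^sub>C u i"
    using vi by (simp add: z_def rank_one_def cinner_self scale_left_diff_distrib algebra_simps)
  have "op_adjoint z (u i) = of_real \<mu> *\<^sub>C v i"
    by (rule onb_ext[OF svdD(2)[OF s]])
      (simp add: op_adjoint_cinner'[OF zop] svdD(4)[OF s] cinner_linear \<mu>)
  then have yu: "op_adjoint y (u i) = of_real (\<mu> - 1) *\<^sub>C v i"
    using ui by (simp add: adj rank_one_def cinner_self scale_left_diff_distrib algebra_simps)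
  obtain v' u' c' where y': "svd y v' u' c'" and 0: "v' 0 = v i" "u' 0 = u i" "c' 0 = \<mu> - 1" "0 < hdim"
    by (rule svd_pair[OF y vi ui yv yu]) blast
  have un: "hnorm (of_real \<kappa> *\<^sub>C u i) = \<bar>\<kappa>\<bar>" for \<kappa>
    by (simp add: hnorm_scale ui)
  \<comment> \<open>Both operators have \<open>schatten_pow\<close> equal to 1, so the perturbed
    values compare directly. Subtracting the cases \<open>\<kappa> = 1\<close> and
    \<open>\<kappa> = -1\<close> below removes \<open>\<bar>s i\<bar> powr p\<close> and
    \<open>\<bar>\<mu> - 1\<bar> powr p\<close>.\<close>
  have val: "\<bar>s i + \<kappa>\<bar> powr p - \<bar>s i\<bar> powr p = \<bar>(\<mu> - 1) + \<kappa>\<bar> powr p - \<bar>\<mu> - 1\<bar> powr p" if "\<bar>\<kappa>\<bar> = 1" for \<kappa>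
    using schatten_pow_add_singular_pair[OF x i(1) p(1), of \<kappa>]
      schatten_pow_add_singular_pair[OF y' 0(4) p(1), of \<kappa>] eq[OF _ vi, of "of_real \<kappa> *\<^sub>C u i"]
      un[of \<kappa>] that nx by (simp add: 0)
  have "s i = \<mu> - 1"
  proof (rule powr_difference_inj[OF p(1)])
    show "\<bar>s i\<bar> \<le> 1" using svd_coeff_le_1[OF x i(1) p(1)] nx by simp
    show "\<bar>\<mu> - 1\<bar> \<le> 1" using svd_coeff_le_1[OF y' 0(4) p(1)] nx 0 by simp
    show "\<bar>s i + 1\<bar> powr p - \<bar>s i - 1\<bar> powr p = \<bar>\<mu> - 1 + 1\<bar> powr p - \<bar>\<mu> - 1 - 1\<bar> powr p"
      using val[of 1] val[of "-1"] by simp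
  qed
  then show ?thesis using yv by simp
qed

section \<open>The trace norm case \<open>p = 1\<close>\<close>

text \<open>The unitary carrying \<open>g\<close> to \<open>f\<close>. It serves as
  \<open>T\<close>, turning \<open>z\<close> into its absolute value, and as \<open>V\<close>,
  turning the numbers \<open>cinner (y (v j)) (u j)\<close> into a trace.\<close>

lemma onb_change:
  assumes "onb g" "onb f"
  defines "T \<equiv> \<lambda>a. \<Sum>k<hdim. cinner a (g k) *\<^sub>C f k"
  shows onb_change_operators: "T \<in> operators"
    and onb_change_apply: "k < hdim \<Longrightarrow> T (g k) = f k"
    and onb_change_cinner: "cinner (T a) (T b) = cinner a b"
    and onb_change_hnorm: "hnorm (T a) = hnorm a"
proof -
  show "T \<in> operators" unfolding T_def using diagonal_operators[of "\<lambda>_. 1" g f] by simp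
  show "k < hdim \<Longrightarrow> T (g k) = f k"
    unfolding T_def using diagonal_apply[OF assms(1), of k "\<lambda>_. 1" f] by simp
  have Tf: "cinner (T a) (f k) = cinner a (g k)" if "k < hdim" for a k
    unfolding T_def using onfam_sum_cinner[OF assms(2) finite_lessThan, of k] that by simp
  have c: "cinner (T a) (T b) = cinner a b" for a b
  proof -
    have "cinner (T a) (T b) = (\<Sum>k<hdim. cinner (T a) (f k) * cnj (cinner (T b) (f k)))"
      by (subst onb_parseval[OF assms(2)]) (simp add: cinner_commute[of "f _" "T b"])
    also have "\<dots> = (\<Sum>k<hdim. cinner a (g k) * cnj (cinner b (g k)))"
      by (simp add: Tf)
    also have "\<dots> = cinner a b"
      by (subst onb_parseval[OF assms(1), of a b]) (simp add: cinner_commute[of "g _" b])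
    finally show ?thesis .
  qed
  then show "cinner (T a) (T b) = cinner a b" .
  show "hnorm (T a) = hnorm a" by (simp add: hnorm_def c)
qed

lemma hnorm_reflection:
  assumes "hnorm v = 1"
  shows "hnorm (b - (2 * cinner b v) *\<^sub>C v) = hnorm b"
proof -
  have "cinner v v = 1" using assms by (simp add: cinner_self)
  then have "cinner (b - (2 * cinner b v) *\<^sub>C v) (b - (2 * cinner b v) *\<^sub>C v) = cinner b b"
    by (simp add: cinner_linear cinner_commute[of v b] algebra_simps)
  then show ?thesis by (simp add: hnorm_def)
qed

text \<open>For \<open>p = 1\<close> the first-order condition does not see the singular values. Instead,
  \<open>z = y + u\<^sub>i \<otimes> v\<^sub>i\<close> has trace norm \<open>2\<close>, so the unitary \<open>T\<close> with \<open>T z = |z|\<close> maps \<open>u\<^sub>i\<close> to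
  \<open>v\<^sub>i\<close> and makes \<open>T y\<close> positive; testing \<open>y - u\<^sub>i \<otimes> v\<^sub>i\<close> against \<open>T\<close> followed by the reflection in
  \<open>v\<^sub>i\<close> then bounds the diagonal of \<open>y\<close> from below.\<close>

lemma singular_pair_transfer_trace_norm:
  assumes x: "svd x v u s" and s: "\<And>i. 0 \<le> s i" and y: "y \<in> operators"
    and nx: "schatten_pow 1 x = 1" "schatten_pow 1 y = 1"
    and eq: "\<And>\<eta> \<xi>. hnorm \<eta> = 1 \<Longrightarrow> hnorm \<xi> = 1 \<Longrightarrow>
      schatten_pow 1 (\<lambda>a. x a + rank_one \<eta> \<xi> a) = schatten_pow 1 (\<lambda>a. y a + rank_one \<eta> \<xi> a)"
    and i: "i < hdim"
  shows "y (v i) = of_real (s i) *\<^sub>C u i"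
proof -
  note v = svdD(2)[OF x] and u = svdD(3)[OF x]
  \<comment> \<open>The lower bound is needed at every index before equality follows at any of them,
    so the construction is done for arbitrary \<open>i\<close> and the equality case is kept as an
    implication.\<close>
  have key: "\<exists>T T'. T \<in> operators \<and> T' \<in> operators \<and> (\<forall>a b. cinner (T a) (T b) = cinner a b) \<and>
      (\<forall>a b. cinner (T (y a)) b = cinner a (T (y b))) \<and> T (u i) = v i \<and>
      (\<forall>a. T' a = T a - (2 * cinner (T a) (v i)) *\<^sub>C v i) \<and>
      s i \<le> Re (cinner (y (v i)) (u i)) \<and>
      (Re (cinner (y (v i)) (u i)) = s i \<longrightarrow>
        (\<forall>a b. cinner (T' (y a - rank_one (u i) (v i) a)) b = cinner a (T' (y b - rank_one (u i) (v i) b))))"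
    if i: "i < hdim" for i
  proof -
    have vi: "hnorm (v i) = 1" and ui: "hnorm (u i) = 1"
      using onfam_hnorm[OF v] onfam_hnorm[OF u] i by auto
    have vivi: "cinner (v i) (v i) = 1" using vi by (simp add: cinner_self)
    define z where "z = (\<lambda>a. y a + rank_one (u i) (v i) a)"
    define z' where "z' = (\<lambda>a. y a - rank_one (u i) (v i) a)"
    have zop: "z \<in> operators" unfolding z_def by (intro operators_plus y rank_one_operators)
    have z'op: "z' \<in> operators" unfolding z'_def by (intro operators_minus y rank_one_operators)
    have si: "s i \<le> 1" using svd_coeff_le_1[OF x i, of 1] nx s[of i] by simp
    have nz: "schatten_pow 1 z = 2"
      using eq[OF ui vi] schatten_pow_add_singular_pair[OF x i, of 1 1] nx(1) s[of i] by (simp add: z_def)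
    have "schatten_pow 1 (\<lambda>a. x a + rank_one (of_real (-1) *\<^sub>C u i) (v i) a) = 2 - 2 * s i"
      using schatten_pow_add_singular_pair[OF x i, of 1 "-1"] nx(1) s[of i] si by simp
    moreover have "hnorm (of_real (-1) *\<^sub>C u i) = 1"
      by (simp only: hnorm_scale ui) simp
    moreover have "(\<lambda>a. y a + rank_one (of_real (-1) *\<^sub>C u i) (v i) a) = z'"
      by (simp add: z'_def rank_one_def)
    ultimately have nz': "schatten_pow 1 z' = 2 - 2 * s i"
      using eq[of "of_real (-1) *\<^sub>C u i" "v i"] vi by simp
    obtain f g \<sigma> where sz: "svd z f g \<sigma>" and \<sigma>: "\<And>k. 0 \<le> \<sigma> k"
      using svd_exists[OF zop] by metis
    note f = svdD(2)[OF sz] and g = svdD(3)[OF sz]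
    define T where "T a = (\<Sum>k<hdim. cinner a (g k) *\<^sub>C f k)" for a
    note T = onb_change[OF g f, folded T_def]
    have "op_trace (T \<circ> z) = (\<Sum>k<hdim. of_real (\<sigma> k))"
      unfolding onb_trace[OF f operators_comp[OF T(1) zop]]
      by (intro sum.cong refl)
        (simp add: svdD(4)[OF sz] operators_scale[OF T(1)] T(2) cinner_scale_left onfamD[OF f])
    moreover have "schatten_pow 1 z = (\<Sum>k<hdim. \<sigma> k)"
      using \<sigma> by (simp add: schatten_pow_svd[OF sz])
    ultimately have trz: "Re (op_trace (T \<circ> z)) = 2" using nz by simp
    have ri: "rank_one (u i) (v i) (v j) = (if j = i then u i else 0)" if "j < hdim" for j
      using that i onfamD[OF v, of j i] by (simp add: rank_one_def)
    have "op_trace (T \<circ> z) = (\<Sum>j<hdim. cinner (T (y (v j))) (v j) + (if j = i then cinner (T (u i)) (v i) else 0))"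
      unfolding onb_trace[OF v operators_comp[OF T(1) zop]]
      by (intro sum.cong refl)
        (auto simp: z_def ri operators_add[OF T(1)] operators_0[OF T(1)] cinner_linear)
    also have "\<dots> = op_trace (T \<circ> y) + cinner (T (u i)) (v i)"
      using i by (simp add: sum.distrib onb_trace[OF v operators_comp[OF T(1) y]])
    finally have sum2: "Re (op_trace (T \<circ> y)) + Re (cinner (T (u i)) (v i)) = 2"
      using trz by simp
    have Tle: "hnorm (T a) \<le> hnorm a" for a using T(4)[of a] by simp
    have Tu: "hnorm (T (u i)) \<le> 1" using T(4)[of "u i"] ui by simp
    \<comment> \<open>The two summands in \<open>sum2\<close> are at most 1 each and add up to
      2.\<close>
    have Ty: "Re (op_trace (T \<circ> y)) = 1" and Tuv: "Re (cinner (T (u i)) (v i)) = 1"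
      using sum2 trace_contraction_le[OF y T(1) Tle] Re_cinner_le_1[OF Tu vi] nx(2) by linarith+
    have Tui: "T (u i) = v i" by (rule Re_cinner_eq_1[OF Tu vi Tuv])
    have sa: "cinner (T (y a)) b = cinner a (T (y b))" for a b
      using trace_contraction_eq[OF y T(1) Tle] Ty nx(2) by simp
    have diag: "cinner (T (y (v i))) (v i) = cinner (y (v i)) (u i)"
      using T(3)[of "y (v i)" "u i"] Tui by simp
    define T' where "T' a = T a - (2 * cinner (T a) (v i)) *\<^sub>C v i" for a
    have T'op: "T' \<in> operators"
      by (rule operatorsI) (simp_all add: T'_def operators_add[OF T(1)] operators_scale[OF T(1)]
          cinner_linear algebra_simps scale_left_distrib scale_right_diff_distrib)
    have T'le: "hnorm (T' a) \<le> hnorm a" for a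
      unfolding T'_def using hnorm_reflection[OF vi, of "T a"] T(4)[of a] by simp
    have T'v: "cinner (T' a) (v j) = (if j = i then - cinner (T a) (v i) else cinner (T a) (v j))"
      if "j < hdim" for a j
      using that i onfamD[OF v, of i j] by (auto simp: T'_def cinner_linear vivi)
    \<comment> \<open>The reflection flips the sign of the diagonal entry at \<open>i\<close>, which
      is \<open>cinner (T (y (v i))) (v i) - 1\<close>, and leaves the others alone. Comparing with
      the trace norm \<open>2 - 2 * s i\<close> of \<open>z'\<close> gives the lower bound.\<close>
    have "op_trace (T' \<circ> z') = (\<Sum>j<hdim. cinner (T (y (v j))) (v j) +
        (if j = i then 1 - 2 * cinner (T (y (v i))) (v i) else 0))"
      unfolding onb_trace[OF v operators_comp[OF T'op z'op]]
      by (intro sum.cong refl)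
        (auto simp: z'_def ri operators_diff[OF T'op] operators_0[OF T(1)] T'v cinner_linear Tui vivi)
    also have "\<dots> = op_trace (T \<circ> y) + (1 - 2 * cinner (T (y (v i))) (v i))"
      using i by (simp add: sum.distrib onb_trace[OF v operators_comp[OF T(1) y]])
    finally have tr': "Re (op_trace (T' \<circ> z')) = 2 - 2 * Re (cinner (y (v i)) (u i))"
      using Ty diag by simp
    have le: "s i \<le> Re (cinner (y (v i)) (u i))"
      using trace_contraction_le[OF z'op T'op T'le] tr' nz' by simp
    have "cinner (T' (z' a)) b = cinner a (T' (z' b))" if "Re (cinner (y (v i)) (u i)) = s i" for a b
      using trace_contraction_eq[OF z'op T'op T'le] tr' nz' that by simp
    then show ?thesis
      using T(1) T'op T(3) sa Tui le by (intro exI[of _ T] exI[of _ T']) (auto simp: T'_def z'_def)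
  qed
  then have le: "s i \<le> Re (cinner (y (v i)) (u i))" if "i < hdim" for i
    using that by blast
  have "Re (cinner (y (v i)) (u i)) = s i"
  proof -
    \<comment> \<open>Testing \<open>y\<close> against \<open>V\<close> bounds the sum of the
      \<open>Re (cinner (y (v j)) (u j))\<close> by 1, the sum of the \<open>s j\<close>; together
      with the lower bounds this forces equality in each.\<close>
    define V where "V a = (\<Sum>k<hdim. cinner a (u k) *\<^sub>C v k)" for a
    note V = onb_change[OF u v, folded V_def]
    have Vle: "hnorm (V a) \<le> hnorm a" for a using V(4)[of a] by simp
    have "cinner (V (y (v j))) (v j) = cinner (y (v j)) (u j)" if "j < hdim" for j
      using V(3)[of "y (v j)" "u j"] V(2)[OF that] by simp
    then have "op_trace (V \<circ> y) = (\<Sum>j<hdim. cinner (y (v j)) (u j))"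
      by (simp add: onb_trace[OF v operators_comp[OF V(1) y]])
    then have "(\<Sum>j<hdim. Re (cinner (y (v j)) (u j))) \<le> 1"
      using trace_contraction_le[OF y V(1) Vle] nx(2) by simp
    moreover have "(\<Sum>j<hdim. s j) = 1"
      using nx(1) s by (simp add: schatten_pow_svd[OF x])
    ultimately have "(\<Sum>j<hdim. Re (cinner (y (v j)) (u j)) - s j) \<le> 0"
      by (simp add: sum_subtractf)
    moreover have "0 \<le> (\<Sum>j<hdim. Re (cinner (y (v j)) (u j)) - s j)"
      using le by (intro sum_nonneg) auto
    ultimately have "(\<Sum>j<hdim. Re (cinner (y (v j)) (u j)) - s j) = 0" by simp
    then have "\<forall>j\<in>{..<hdim}. Re (cinner (y (v j)) (u j)) - s j = 0"
      by (subst (asm) sum_nonneg_eq_0_iff) (use le in auto)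
    then show ?thesis using i by simp
  qed
  then obtain T T' where T: "T \<in> operators" "T' \<in> operators" "\<And>a b. cinner (T a) (T b) = cinner a b"
      "\<And>a b. cinner (T (y a)) b = cinner a (T (y b))" "T (u i) = v i"
    and T': "\<And>a. T' a = T a - (2 * cinner (T a) (v i)) *\<^sub>C v i"
      "\<And>a b. cinner (T' (y a - rank_one (u i) (v i) a)) b = cinner a (T' (y b - rank_one (u i) (v i) b))"
    using key[OF i] by blast
  have vivi: "cinner (v i) (v i) = 1" using onfamD[OF v, of i i] i by simp
  define \<kappa> where "\<kappa> = cinner (T (y (v i))) (v i)"
  have e: "T' (y b - rank_one (u i) (v i) b) =
      T (y b) - (2 * cinner (T (y b)) (v i)) *\<^sub>C v i + cinner b (v i) *\<^sub>C v i" for b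
  proof -
    have "T' (y b - rank_one (u i) (v i) b) = T' (y b) - cinner b (v i) *\<^sub>C T' (u i)"
      by (simp add: rank_one_def operators_diff[OF T(2)] operators_scale[OF T(2)])
    also have "T' (u i) = - v i"
    proof -
      have "T' (u i) = 1 *\<^sub>C v i - 2 *\<^sub>C v i"
        by (simp add: T'(1) T(5) vivi)
      also have "\<dots> = (1 - 2) *\<^sub>C v i"
        by (rule scale_left_diff_distrib[symmetric])
      finally show ?thesis by simp
    qed
    finally show ?thesis by (simp add: T'(1))
  qed
  \<comment> \<open>By \<open>e\<close> and the self-adjointness of both compositions, the rank-one
    map sending \<open>b\<close> to \<open>cinner (T (y b)) (v i)\<close> times \<open>v i\<close>
    is self-adjoint as well. Evaluating this at \<open>v i\<close> makes \<open>T (y (v i))\<close>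
    a multiple of \<open>v i\<close>.\<close>
  have "T (y (v i)) = \<kappa> *\<^sub>C v i"
  proof (rule cinner_ext)
    fix w
    have "cinner (v i) (T (y w)) = cinner (T (y (v i))) w" by (simp add: T(4))
    moreover have "cnj (cinner (T (y w)) (v i)) = cinner (v i) (T (y w))" by (metis cinner_commute)
    moreover have "cnj (cinner w (v i)) = cinner (v i) w" by (metis cinner_commute)
    ultimately show "cinner (T (y (v i))) w = cinner (\<kappa> *\<^sub>C v i) w"
      using T'(2)[of "v i" w] unfolding e by (simp add: cinner_linear \<kappa>_def vivi)
  qed
  moreover have "\<kappa> = of_real (s i)"
  proof -
    have "\<kappa> = cinner (y (v i)) (u i)"
      using T(3)[of "y (v i)" "u i"] T(5) by (simp add: \<kappa>_def)
    moreover have "cnj \<kappa> = \<kappa>"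
      unfolding \<kappa>_def by (metis T(4) cinner_commute)
    ultimately show ?thesis
      using \<open>Re (cinner (y (v i)) (u i)) = s i\<close> by (auto simp: complex_eq_iff)
  qed
  ultimately have "T (y (v i)) = T (of_real (s i) *\<^sub>C u i)"
    by (simp add: operators_scale[OF T(1)] T(5))
  then have "cinner (y (v i) - of_real (s i) *\<^sub>C u i) (y (v i) - of_real (s i) *\<^sub>C u i) = 0"
    by (subst T(3)[symmetric]) (simp add: operators_diff[OF T(1)])
  then show ?thesis by simp
qed

end

section \<open>Agreement of \<open>x\<close> and \<open>y\<close> on a singular basis of
  \<open>x\<close>\<close>

theorem proposition3p8:
  fixes scaleC :: "complex \<Rightarrow> 'a::ab_group_add \<Rightarrow> 'a"
    and cinner :: "'a \<Rightarrow> 'a \<Rightarrow> complex"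
    and p :: real
    and x y :: "'a \<Rightarrow> 'a"
  assumes "fin_dim_complex_hilbert scaleC cinner"
    and "0 < p" and "p \<noteq> 2"
    and "x \<in> fin_dim_complex_hilbert.schatten_sphere scaleC cinner p"
    and "y \<in> fin_dim_complex_hilbert.schatten_sphere scaleC cinner p"
    and "\<forall>e \<in> fin_dim_complex_hilbert.minimal_partial_isometries scaleC cinner.
      fin_dim_complex_hilbert.schatten_norm scaleC cinner p (\<lambda>v. x v - e v) powr p =
      fin_dim_complex_hilbert.schatten_norm scaleC cinner p (\<lambda>v. y v - e v) powr p"
  shows "x = y"
proof -
  interpret fin_dim_complex_hilbert scaleC cinner by fact
  have x: "x \<in> operators" "schatten_pow p x = 1" and y: "y \<in> operators" "schatten_pow p y = 1"
    using assms(4,5) by (auto simp: schatten_sphere_def schatten_pow_def)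
  \<comment> \<open>The hypothesis subtracts \<open>e\<close>; building \<open>e\<close> from the
    unit vector \<open>- \<eta>\<close> turns the difference into a sum.\<close>
  have eq: "schatten_pow p (\<lambda>a. x a + rank_one \<eta> \<xi> a) = schatten_pow p (\<lambda>a. y a + rank_one \<eta> \<xi> a)"
    if "hnorm \<eta> = 1" "hnorm \<xi> = 1" for \<eta> \<xi>
  proof -
    have "hnorm (- \<eta>) = 1"
      using hnorm_scale[of "-1" \<eta>] that by simp
    then have "rank_one (- \<eta>) \<xi> \<in> minimal_partial_isometries"
      using that by (auto simp: minimal_partial_isometries_def)
    then show ?thesis
      using bspec[OF assms(6)] by (fastforce simp: schatten_pow_def rank_one_def)
  qed
  obtain v u s where s: "svd x v u s" "\<And>i. 0 \<le> s i"
    using svd_exists[OF x(1)] by metis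
  have "y (v i) = scaleC (of_real (s i)) (u i)" if "i < hdim" for i
  proof (cases "p = 1")
    case True
    show ?thesis
      by (rule singular_pair_transfer_trace_norm[OF s y(1) _ _ _ that]) (use True x y eq in auto)
  next
    case False
    then show ?thesis
      using singular_pair_transfer[OF s(1) that s(2) y(1) assms(2) False x(2) y(2) eq] by blast
  qed
  then show ?thesis
    by (intro operators_ext_onb[OF svdD(2)[OF s(1)] x(1) y(1)]) (simp add: svdD(4)[OF s(1)])
qed

end
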